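(* For the simplex method with the steepest-edge pivot rule, started at any vertex and for any objective, the number of visited vertices is bounded by: (a) $m\lceil 2n\sqrt n\log(2n)\rceil$ for the fractional perfect matching polytope of a graph with $n$ nodes and $m$ edges; for the complete graph $K_n$ this gives a bound $\sim n^3\sqrt n\log n$; (b) $m\lceil 4n\sqrt{2n}\log(2n)\rceil$ for the fractional matching polytope of a graph with $n$ nodes and $m\ge1$ edges; for $K_n$ this gives a bound $\sim 2n^3\sqrt{2n}\log n$; (c) $n^2\left\lceil n\sqrt{\frac n2}\log(2n-1)\right\rceil\sim n^3\sqrt{\frac n2}\log n$ for the Birkhoff polytope on $K_{n,n}$, $n\ge2$; (d) $(n^2-2n+1)\left\lceil (n-1)\sqrt{\frac{2n}{3}}\log(n-1)\right\rceil\sim n^3\sqrt{\frac{2n}{3}}\log n$ for the shortest path polytope on $n\ge3$ nodes.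
   Context: $\log$ is the natural logarithm; $\sim$ denotes asymptotic equivalence as $n\to\infty$. For a graph $G=(V,E)$, with $x(\delta(v))$ the sum of $x_e$ over edges $e$ incident to $v$: the fractional perfect matching polytope is $\{x\in\mathbb{R}^E: x\ge0,\ x(\delta(v))=1\ \forall v\in V\}$; the fractional matching polytope is $\{x\in\mathbb{R}^E: x\ge0,\ x(\delta(v))\le1\ \forall v\in V\}$, put in standard form by adding one slack variable per node. The Birkhoff polytope on $K_{n,n}$ is the set of $x\in\mathbb{R}^{n\times n}$, $x\ge0$, with all row and column sums equal to 1. The shortest path polytope on $n$ nodes is given by variables $x_{i,j}\ge0$ ($1\le i\le n-1$, $2\le j\le n$, $i\ne j$) with $\sum_{j=2}^n x_{1,j}=1$ and, for $2\le i\le n-1$, $\sum_{j\ne i}x_{i,j}-\sum_{j\ne i}x_{j,i}=0$ and $\sum_{j\neq i}x_{i,j}\le1$, the inequalities being put in standard form with slack variables. The simplex method is run on the standard form LP $\min c^Tx$, $Ax=b$, $x\ge0$ (redundant equations removed so that $A$ has full row rank), with $c$ nondegenerate (no two vertices of the polytope have the same objective value). At a basic feasible solution (BFS) with basis $B$ and nonbasic columns $N$, for each nonbasic index $q$ let $\eta^q$ be the edge direction with nonbasic part the unit vector of $q$ and basic part $-B^{-1}A_q$, and let $\bar c^q=c^T\eta^q$ be the reduced cost. The steepest-edge rule chooses as entering variable a $q$ minimizing $\bar c^q/\|\eta^q\|_2$ (as long as this minimum is negative), and the leaving variable is determined by the ratio test. The number of visited vertices is the number of different BFS (as points) generated. 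*)

theory Defs
  imports "HOL-Analysis.Analysis" "HOL-Library.Landau_Symbols" "HOL-Library.Extended_Nat"
begin

section \<open>Standard form linear programs\<close>

text \<open>Rows and columns are indexed by arbitrary finite sets. A vector indexed by the columns is a
  function that vanishes outside the column set, so that equality of points is equality of functions.\<close>

record ('r, 'c) std_form =
  rows :: "'r set"
  cols :: "'c set"
  mat_A :: "'r \<Rightarrow> 'c \<Rightarrow> real"
  vec_b :: "'r \<Rightarrow> real"

definition solutions :: "('r, 'c) std_form \<Rightarrow> ('c \<Rightarrow> real) set" where
  "solutions L = {x. (\<forall>j. j \<notin> cols L \<longrightarrow> x j = 0) \<and>
     (\<forall>i\<in>rows L. (\<Sum>j\<in>cols L. mat_A L i j * x j) = vec_b L i)}"

definition feasible_set :: "('r, 'c) std_form \<Rightarrow> ('c \<Rightarrow> real) set" where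
  "feasible_set L = {x \<in> solutions L. \<forall>j\<in>cols L. 0 \<le> x j}"

definition vertices :: "('c \<Rightarrow> real) set \<Rightarrow> ('c \<Rightarrow> real) set" where
  "vertices P = {x \<in> P. \<not> (\<exists>y\<in>P. \<exists>z\<in>P. \<exists>u. y \<noteq> z \<and> 0 < u \<and> u < 1 \<and>
     x = (\<lambda>j. (1 - u) * y j + u * z j))}"

definition full_row_rank :: "('r, 'c) std_form \<Rightarrow> bool" where
  "full_row_rank L \<longleftrightarrow>
     (\<forall>u. (\<forall>j\<in>cols L. (\<Sum>i\<in>rows L. u i * mat_A L i j) = 0) \<longrightarrow> (\<forall>i\<in>rows L. u i = 0))"

text \<open>\<open>L'\<close> arises from \<open>L\<close> by deleting redundant equations until the matrix has full row rank.\<close>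

definition irredundant_form :: "('r, 'c) std_form \<Rightarrow> ('r, 'c) std_form \<Rightarrow> bool" where
  "irredundant_form L L' \<longleftrightarrow>
     (\<exists>R \<subseteq> rows L. L' = L\<lparr>rows := R\<rparr>) \<and> solutions L' = solutions L \<and> full_row_rank L'"

definition objective :: "('r, 'c) std_form \<Rightarrow> ('c \<Rightarrow> real) \<Rightarrow> ('c \<Rightarrow> real) \<Rightarrow> real" where
  "objective L c x = (\<Sum>j\<in>cols L. c j * x j)"

definition nondegenerate_objective :: "('r, 'c) std_form \<Rightarrow> ('c \<Rightarrow> real) \<Rightarrow> bool" where
  "nondegenerate_objective L c \<longleftrightarrow> inj_on (objective L c) (vertices (feasible_set L))"


section \<open>The simplex method with the steepest-edge rule\<close>

text \<open>A basis is given by its set of columns: the square submatrix formed by them is nonsingular.\<close>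

definition is_basis :: "('r, 'c) std_form \<Rightarrow> 'c set \<Rightarrow> bool" where
  "is_basis L B \<longleftrightarrow> B \<subseteq> cols L \<and> card B = card (rows L) \<and>
     (\<forall>u. (\<forall>i\<in>rows L. (\<Sum>j\<in>B. mat_A L i j * u j) = 0) \<longrightarrow> (\<forall>j\<in>B. u j = 0))"

definition basic_solution :: "('r, 'c) std_form \<Rightarrow> 'c set \<Rightarrow> 'c \<Rightarrow> real" where
  "basic_solution L B = (THE x. x \<in> solutions L \<and> (\<forall>j. j \<notin> B \<longrightarrow> x j = 0))"

definition feasible_basis :: "('r, 'c) std_form \<Rightarrow> 'c set \<Rightarrow> bool" where
  "feasible_basis L B \<longleftrightarrow> is_basis L B \<and> basic_solution L B \<in> feasible_set L"

text \<open>The vector \<open>B\<^sup>-\<^sup>1 A\<^sub>q\<close>, indexed by \<open>B\<close>.\<close>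

definition basis_inv_col :: "('r, 'c) std_form \<Rightarrow> 'c set \<Rightarrow> 'c \<Rightarrow> 'c \<Rightarrow> real" where
  "basis_inv_col L B q = (THE d. (\<forall>j. j \<notin> B \<longrightarrow> d j = 0) \<and>
     (\<forall>i\<in>rows L. (\<Sum>j\<in>B. mat_A L i j * d j) = mat_A L i q))"

definition edge_direction :: "('r, 'c) std_form \<Rightarrow> 'c set \<Rightarrow> 'c \<Rightarrow> 'c \<Rightarrow> real" where
  "edge_direction L B q j =
     (if j \<in> B then - basis_inv_col L B q j else if j = q then 1 else 0)"

definition reduced_cost :: "('r, 'c) std_form \<Rightarrow> ('c \<Rightarrow> real) \<Rightarrow> 'c set \<Rightarrow> 'c \<Rightarrow> real" where
  "reduced_cost L c B q = objective L c (edge_direction L B q)"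

definition steepness :: "('r, 'c) std_form \<Rightarrow> ('c \<Rightarrow> real) \<Rightarrow> 'c set \<Rightarrow> 'c \<Rightarrow> real" where
  "steepness L c B q = reduced_cost L c B q / L2_set (edge_direction L B q) (cols L)"

definition steepest_edge_entering ::
    "('r, 'c) std_form \<Rightarrow> ('c \<Rightarrow> real) \<Rightarrow> 'c set \<Rightarrow> 'c \<Rightarrow> bool" where
  "steepest_edge_entering L c B q \<longleftrightarrow> q \<in> cols L - B \<and> steepness L c B q < 0 \<and>
     (\<forall>q'\<in>cols L - B. steepness L c B q \<le> steepness L c B q')"

definition ratio_test_leaving :: "('r, 'c) std_form \<Rightarrow> 'c set \<Rightarrow> 'c \<Rightarrow> 'c \<Rightarrow> bool" where
  "ratio_test_leaving L B q p \<longleftrightarrow> p \<in> B \<and> edge_direction L B q p < 0 \<and>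
     (\<forall>k\<in>B. edge_direction L B q k < 0 \<longrightarrow>
        basic_solution L B p / - edge_direction L B q p
          \<le> basic_solution L B k / - edge_direction L B q k)"

text \<open>Ties in the choice of the entering and of the leaving variable may be broken arbitrarily,
  hence a relation; degenerate pivots are included.\<close>

definition steepest_edge_pivot ::
    "('r, 'c) std_form \<Rightarrow> ('c \<Rightarrow> real) \<Rightarrow> 'c set \<Rightarrow> 'c set \<Rightarrow> bool" where
  "steepest_edge_pivot L c B B' \<longleftrightarrow>
     (\<exists>q p. steepest_edge_entering L c B q \<and> ratio_test_leaving L B q p \<and>
        B' = insert q (B - {p}))"

text \<open>A run performs \<open>T\<close> pivots; \<open>T = \<infinity>\<close> is possible because the method may cycle at a
  degenerate vertex.\<close>

definition steepest_edge_run ::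
    "('r, 'c) std_form \<Rightarrow> ('c \<Rightarrow> real) \<Rightarrow> (nat \<Rightarrow> 'c set) \<Rightarrow> enat \<Rightarrow> bool" where
  "steepest_edge_run L c Bs T \<longleftrightarrow> feasible_basis L (Bs 0) \<and>
     (\<forall>t. enat t < T \<longrightarrow> steepest_edge_pivot L c (Bs t) (Bs (Suc t)))"

definition visited_vertices ::
    "('r, 'c) std_form \<Rightarrow> (nat \<Rightarrow> 'c set) \<Rightarrow> enat \<Rightarrow> ('c \<Rightarrow> real) set" where
  "visited_vertices L Bs T = {basic_solution L (Bs t) | t. enat t \<le> T}"


section \<open>Polytopes given by equations and inequalities\<close>

text \<open>The system \<open>x \<ge> 0\<close>, \<open>(lhs x) i = rhs i\<close> for \<open>i\<close> in \<open>eq_rows\<close> and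
  \<open>(lhs x) i \<le> rhs i\<close> for \<open>i\<close> in \<open>le_rows\<close>; the two row sets are meant to be disjoint.\<close>

record ('r, 'c) lin_system =
  variables :: "'c set"
  eq_rows :: "'r set"
  le_rows :: "'r set"
  lhs :: "'r \<Rightarrow> 'c \<Rightarrow> real"
  rhs :: "'r \<Rightarrow> real"

definition system_polytope :: "('r, 'c) lin_system \<Rightarrow> ('c \<Rightarrow> real) set" where
  "system_polytope S = {x. (\<forall>j. j \<notin> variables S \<longrightarrow> x j = 0) \<and> (\<forall>j\<in>variables S. 0 \<le> x j) \<and>
     (\<forall>i\<in>eq_rows S. (\<Sum>j\<in>variables S. lhs S i j * x j) = rhs S i) \<and>
     (\<forall>i\<in>le_rows S. (\<Sum>j\<in>variables S. lhs S i j * x j) \<le> rhs S i)}"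

text \<open>\<open>Inr k\<close> is the slack variable of the inequality \<open>k\<close>.\<close>

definition standard_form :: "('r, 'c) lin_system \<Rightarrow> ('r, 'c + 'r) std_form" where
  "standard_form S = \<lparr>
     rows = eq_rows S \<union> le_rows S,
     cols = Inl ` variables S \<union> Inr ` le_rows S,
     mat_A = (\<lambda>i. case_sum (lhs S i) (\<lambda>k. of_bool (k = i))),
     vec_b = rhs S\<rparr>"

definition steepest_edge_visits_at_most :: "('r, 'c) lin_system \<Rightarrow> real \<Rightarrow> bool" where
  "steepest_edge_visits_at_most S K \<longleftrightarrow>
     (\<forall>L c Bs T. irredundant_form (standard_form S) L \<longrightarrow> nondegenerate_objective L c \<longrightarrow>
        steepest_edge_run L c Bs T \<longrightarrow>
        finite (visited_vertices L Bs T) \<and> real (card (visited_vertices L Bs T)) \<le> K)"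

definition simple_graph :: "'v set \<Rightarrow> 'v set set \<Rightarrow> bool" where
  "simple_graph V E \<longleftrightarrow> finite V \<and> V \<noteq> {} \<and> (\<forall>e\<in>E. e \<subseteq> V \<and> card e = 2)"

definition complete_graph_edges :: "nat \<Rightarrow> nat set set" where
  "complete_graph_edges n = {e. e \<subseteq> {1..n} \<and> card e = 2}"

definition fractional_perfect_matching :: "'v set \<Rightarrow> 'v set set \<Rightarrow> ('v, 'v set) lin_system" where
  "fractional_perfect_matching V E = \<lparr>
     variables = E, eq_rows = V, le_rows = {},
     lhs = (\<lambda>v e. of_bool (v \<in> e)), rhs = (\<lambda>v. 1)\<rparr>"

definition fractional_matching :: "'v set \<Rightarrow> 'v set set \<Rightarrow> ('v, 'v set) lin_system" where
  "fractional_matching V E = \<lparr>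
     variables = E, eq_rows = {}, le_rows = V,
     lhs = (\<lambda>v e. of_bool (v \<in> e)), rhs = (\<lambda>v. 1)\<rparr>"

text \<open>\<open>Inl i\<close> is the equation of row \<open>i\<close>, \<open>Inr j\<close> that of column \<open>j\<close>.\<close>

definition birkhoff :: "nat \<Rightarrow> (nat + nat, nat \<times> nat) lin_system" where
  "birkhoff n = \<lparr>
     variables = {1..n} \<times> {1..n}, eq_rows = Inl ` {1..n} \<union> Inr ` {1..n}, le_rows = {},
     lhs = (\<lambda>r (i, j). case r of Inl k \<Rightarrow> of_bool (i = k) | Inr k \<Rightarrow> of_bool (j = k)),
     rhs = (\<lambda>r. 1)\<rparr>"

text \<open>\<open>Inl k\<close> is the equation of node \<open>k\<close>; no arc enters node 1, so for \<open>k = 1\<close> only the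
  outgoing arcs contribute. \<open>Inr k\<close> is the bound on the outflow of node \<open>k\<close>.\<close>

definition shortest_path :: "nat \<Rightarrow> (nat + nat, nat \<times> nat) lin_system" where
  "shortest_path n = \<lparr>
     variables = {(i, j). i \<in> {1..n-1} \<and> j \<in> {2..n} \<and> i \<noteq> j},
     eq_rows = Inl ` {1..n-1}, le_rows = Inr ` {2..n-1},
     lhs = (\<lambda>r (i, j). case r of Inl k \<Rightarrow> of_bool (i = k) - of_bool (j = k)
                               | Inr k \<Rightarrow> of_bool (i = k)),
     rhs = (\<lambda>r. case r of Inl k \<Rightarrow> (if k = 1 then 1 else 0) | Inr k \<Rightarrow> 1)\<rparr>"

lemma system_polytope_fractional_perfect_matching:
  assumes "finite E"
  shows "system_polytope (fractional_perfect_matching V E) =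
    {x. (\<forall>e. e \<notin> E \<longrightarrow> x e = 0) \<and> (\<forall>e\<in>E. 0 \<le> x e) \<and>
        (\<forall>v\<in>V. (\<Sum>e\<in>{e\<in>E. v \<in> e}. x e) = 1)}"
  using assms
  by (simp add: system_polytope_def fractional_perfect_matching_def sum.inter_filter of_bool_def
      if_distrib[where f = "\<lambda>a. a * _"] cong: if_cong)

lemma system_polytope_fractional_matching:
  assumes "finite E"
  shows "system_polytope (fractional_matching V E) =
    {x. (\<forall>e. e \<notin> E \<longrightarrow> x e = 0) \<and> (\<forall>e\<in>E. 0 \<le> x e) \<and>
        (\<forall>v\<in>V. (\<Sum>e\<in>{e\<in>E. v \<in> e}. x e) \<le> 1)}"
  using assms
  by (simp add: system_polytope_def fractional_matching_def sum.inter_filter of_bool_def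
      if_distrib[where f = "\<lambda>a. a * _"] cong: if_cong)

lemma system_polytope_birkhoff:
  "system_polytope (birkhoff n) =
    {x. (\<forall>p. p \<notin> {1..n} \<times> {1..n} \<longrightarrow> x p = 0) \<and> (\<forall>i\<in>{1..n}. \<forall>j\<in>{1..n}. 0 \<le> x (i, j)) \<and>
        (\<forall>i\<in>{1..n}. (\<Sum>j=1..n. x (i, j)) = 1) \<and> (\<forall>j\<in>{1..n}. (\<Sum>i=1..n. x (i, j)) = 1)}"
proof -
  have r: "(\<Sum>(i, j)\<in>{1..n} \<times> {1..n}. of_bool (i = k) * x (i, j)) = (\<Sum>j=1..n. x (k, j))"
    if "k \<in> {1..n}" for k and x :: "nat \<times> nat \<Rightarrow> real"
  proof -
    have "(\<Sum>(i, j)\<in>{1..n} \<times> {1..n}. of_bool (i = k) * x (i, j)) =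
        (\<Sum>i=1..n. if i = k then \<Sum>j=1..n. x (i, j) else 0)"
      by (subst sum.cartesian_product [symmetric]) (rule sum.cong, auto)
    then show ?thesis using that by simp
  qed
  have c: "(\<Sum>(i, j)\<in>{1..n} \<times> {1..n}. of_bool (j = k) * x (i, j)) = (\<Sum>i=1..n. x (i, k))"
    if "k \<in> {1..n}" for k and x :: "nat \<times> nat \<Rightarrow> real"
  proof -
    have "(\<Sum>(i, j)\<in>{1..n} \<times> {1..n}. of_bool (j = k) * x (i, j)) =
        (\<Sum>i=1..n. \<Sum>j=1..n. if j = k then x (i, j) else 0)"
      by (subst sum.cartesian_product [symmetric]) (intro sum.cong, auto)
    then show ?thesis using that by simp
  qed
  show ?thesis
    using r c by (auto simp: system_polytope_def birkhoff_def ball_Un case_prod_unfold)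
qed

lemma system_polytope_shortest_path:
  assumes "n \<ge> 2"
  shows "system_polytope (shortest_path n) =
    {x. (\<forall>i j. \<not> (i \<in> {1..n-1} \<and> j \<in> {2..n} \<and> i \<noteq> j) \<longrightarrow> x (i, j) = 0) \<and>
        (\<forall>i\<in>{1..n-1}. \<forall>j\<in>{2..n}. i \<noteq> j \<longrightarrow> 0 \<le> x (i, j)) \<and>
        (\<Sum>j=2..n. x (1, j)) = 1 \<and>
        (\<forall>i\<in>{2..n-1}.
           (\<Sum>j\<in>{2..n} - {i}. x (i, j)) - (\<Sum>j\<in>{1..n-1} - {i}. x (j, i)) = 0 \<and>
           (\<Sum>j\<in>{2..n} - {i}. x (i, j)) \<le> 1)}"
proof -
  let ?X = "{(i, j). i \<in> {1..n-1} \<and> j \<in> {2..n} \<and> i \<noteq> j}"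
  have fin: "finite ?X"
    by (rule finite_subset [of _ "{1..n-1} \<times> {2..n}"]) auto
  have out: "(\<Sum>(i, j)\<in>?X. of_bool (i = k) * x (i, j)) = (\<Sum>j\<in>{2..n} - {k}. x (k, j))"
    if "k \<in> {1..n-1}" for k and x :: "nat \<times> nat \<Rightarrow> real"
  proof -
    have "(\<Sum>j\<in>{2..n} - {k}. x (k, j)) = (\<Sum>(i, j)\<in>Pair k ` ({2..n} - {k}). of_bool (i = k) * x (i, j))"
      by (subst sum.reindex) (auto simp: inj_on_def)
    also have "\<dots> = (\<Sum>(i, j)\<in>?X. of_bool (i = k) * x (i, j))"
      using that fin by (intro sum.mono_neutral_left) auto
    finally show ?thesis by simp
  qed
  have inc: "(\<Sum>(i, j)\<in>?X. of_bool (j = k) * x (i, j)) = (\<Sum>i\<in>{1..n-1} - {k}. x (i, k))"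
    if "k \<in> {2..n}" for k and x :: "nat \<times> nat \<Rightarrow> real"
  proof -
    have "(\<Sum>i\<in>{1..n-1} - {k}. x (i, k)) =
        (\<Sum>(i, j)\<in>(\<lambda>i. (i, k)) ` ({1..n-1} - {k}). of_bool (j = k) * x (i, j))"
      by (subst sum.reindex) (auto simp: inj_on_def)
    also have "\<dots> = (\<Sum>(i, j)\<in>?X. of_bool (j = k) * x (i, j))"
      using that fin by (intro sum.mono_neutral_left) auto
    finally show ?thesis by simp
  qed
  have inc1: "(\<Sum>(i, j)\<in>?X. of_bool (j = 1) * x (i, j)) = 0" for x :: "nat \<times> nat \<Rightarrow> real"
    by (intro sum.neutral) auto
  have lhs: "(\<Sum>p\<in>?X. lhs (shortest_path n) (Inl k) p * x p) =
      (\<Sum>(i, j)\<in>?X. of_bool (i = k) * x (i, j)) - (\<Sum>(i, j)\<in>?X. of_bool (j = k) * x (i, j))"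
    for k and x :: "nat \<times> nat \<Rightarrow> real"
    by (simp add: shortest_path_def case_prod_unfold left_diff_distrib sum_subtractf)
  have source: "(\<Sum>p\<in>?X. lhs (shortest_path n) (Inl 1) p * x p) = (\<Sum>j=2..n. x (1, j))"
    for x :: "nat \<times> nat \<Rightarrow> real"
    unfolding lhs inc1 using assms by (subst out) auto
  have inner: "(\<Sum>p\<in>?X. lhs (shortest_path n) (Inl k) p * x p) =
      (\<Sum>j\<in>{2..n} - {k}. x (k, j)) - (\<Sum>j\<in>{1..n-1} - {k}. x (j, k))"
    if "k \<in> {2..n-1}" for k and x :: "nat \<times> nat \<Rightarrow> real"
    unfolding lhs using that by (subst out, simp, subst inc) auto
  have bound: "(\<Sum>p\<in>?X. lhs (shortest_path n) (Inr k) p * x p) = (\<Sum>j\<in>{2..n} - {k}. x (k, j))"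
    if "k \<in> {2..n-1}" for k and x :: "nat \<times> nat \<Rightarrow> real"
    using that by (subst out [symmetric]) (auto simp: shortest_path_def case_prod_unfold)
  have split: "{1..n-1} = insert 1 {2..n-1}"
    using assms by auto
  have sel: "variables (shortest_path n) = ?X" "eq_rows (shortest_path n) = Inl ` insert 1 {2..n-1}"
    "le_rows (shortest_path n) = Inr ` {2..n-1}" "rhs (shortest_path n) (Inl 1) = 1"
    "\<And>k. k \<in> {2..n-1} \<Longrightarrow> rhs (shortest_path n) (Inl k) = 0"
    "\<And>k. rhs (shortest_path n) (Inr k) = 1"
    unfolding split [symmetric] by (auto simp: shortest_path_def)
  have eqs: "(\<forall>r\<in>eq_rows (shortest_path n).
        (\<Sum>p\<in>?X. lhs (shortest_path n) r p * x p) = rhs (shortest_path n) r) \<longleftrightarrow>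
      (\<Sum>j=2..n. x (1, j)) = 1 \<and>
      (\<forall>i\<in>{2..n-1}. (\<Sum>j\<in>{2..n} - {i}. x (i, j)) - (\<Sum>j\<in>{1..n-1} - {i}. x (j, i)) = 0)"
    for x :: "nat \<times> nat \<Rightarrow> real"
    unfolding sel(2) ball_simps source sel(4)
    by (intro conj_cong refl ball_cong) (simp only: inner sel(5))
  have les: "(\<forall>r\<in>le_rows (shortest_path n).
        (\<Sum>p\<in>?X. lhs (shortest_path n) r p * x p) \<le> rhs (shortest_path n) r) \<longleftrightarrow>
      (\<forall>i\<in>{2..n-1}. (\<Sum>j\<in>{2..n} - {i}. x (i, j)) \<le> 1)" for x :: "nat \<times> nat \<Rightarrow> real"
    unfolding sel(3) ball_simps by (intro ball_cong refl) (simp only: bound sel(6))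
  have sgn: "(\<forall>p. p \<notin> ?X \<longrightarrow> x p = 0) \<longleftrightarrow>
      (\<forall>i j. \<not> (i \<in> {1..n-1} \<and> j \<in> {2..n} \<and> i \<noteq> j) \<longrightarrow> x (i, j) = 0)"
    "(\<forall>p\<in>?X. 0 \<le> x p) \<longleftrightarrow> (\<forall>i\<in>{1..n-1}. \<forall>j\<in>{2..n}. i \<noteq> j \<longrightarrow> 0 \<le> x (i, j))"
    for x :: "nat \<times> nat \<Rightarrow> real"
    by auto
  show ?thesis
    unfolding system_polytope_def sel(1) eqs les sgn by (rule Collect_cong) blast
qed

end

theory Submission
  imports Defs "HOL-Real_Asymp.Real_Asymp"
begin

text \<open>Let \<open>v\<close> be the gap between the current and the optimal objective value. If \<open>\<sigma> < 0\<close> is the minimal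
  steepness and all edge directions have norm at most \<open>h\<close>, then expanding an optimal point in edge
  directions gives \<open>v \<le> - \<sigma> * h * s\<close>, where \<open>s\<close> bounds the coordinate sums, while a pivot to a vertex at
  distance at least \<open>d\<close> decreases \<open>v\<close> by at least \<open>- \<sigma> * d\<close>. So \<open>v\<close> decays geometrically with ratio
  \<open>1 - d / (h * s)\<close> over the distinct vertices. For optimal dual slacks \<open>S\<close> the gap at \<open>x\<close> is the sum of
  the \<open>S j * x j\<close>; the largest \<open>S j\<close> with \<open>x j > 0\<close> satisfies \<open>v \<le> S j * s\<close>, hence \<open>x j\<close> falls
  below the least positive vertex coordinate \<open>\<delta>\<close>, and so vanishes for good, once \<open>v\<close> has shrunk by the
  factor \<open>\<delta> / s\<close>, that is, after about \<open>h * s / d * ln (s / \<delta>)\<close> new vertices. A dual slack that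
  vanishes on as many columns as there are rows bounds the number of such rounds.

  In the four polytopes, \<open>h\<close>, \<open>d\<close> and \<open>\<delta>\<close> come from the rows \<open>y\<close> of the basis inverse: \<open>y\<close> annihilates
  all basis columns but one, so a level set of \<open>\<bar>y\<bar>\<close> (or of a node potential) that avoids this column
  would contradict nonsingularity.\<close>

section \<open>Square linear systems and Farkas' lemma\<close>

text \<open>Pivots cannot be counted, since a run may stay at a degenerate vertex forever; what is
  counted are changes of the basic point, and pivots that do not move leave the gap as it is. The
  general bound is \<open>(c - r) * K + 1\<close> for \<open>c\<close> columns and \<open>r\<close>
  rows left after deletion, where the 1 is the starting vertex. In three polytopes this 1 is
  absorbed because \<open>r \<ge> 1\<close> and the claimed factor is at least \<open>c\<close>. For
  fractional matchings \<open>c - r\<close> is exactly the number of edges, and \<open>K\<close> is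
  taken one below the ceiling instead. Constants: \<open>s = n/2\<close>,
  \<open>\<delta> = d = 1/2\<close>, \<open>h = sqrt (4 * r + 1)\<close> for perfect matchings; the
  same with \<open>s = n\<close> for matchings; \<open>s = n\<close>, \<open>\<delta> = 1\<close>,
  \<open>d = 2\<close>, \<open>h = sqrt (2 * n)\<close> for Birkhoff; the Birkhoff values with
  \<open>n - 1\<close> for shortest paths. Halves arise because both ends of the exceptional edge
  may lie in one level set of \<open>\<bar>y\<bar>\<close>. A potential takes different values at
  the ends of the exceptional arc, so there everything is integral.\<close>

lemma homogeneous_system_nontrivial_solution:
  fixes A :: "'r \<Rightarrow> 'c \<Rightarrow> real"
  assumes "finite R" "finite C" "card R < card C"
  shows "\<exists>u. (\<exists>j\<in>C. u j \<noteq> 0) \<and> (\<forall>i\<in>R. (\<Sum>j\<in>C. A i j * u j) = 0)"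
  using assms
proof (induction R arbitrary: C A rule: finite_induct)
  case empty
  then have "C \<noteq> {}" by auto
  then show ?case by (intro exI[of _ "\<lambda>_. 1"]) auto
next
  case (insert r R)
  show ?case
  proof (cases "\<forall>j\<in>C. A r j = 0")
    case True
    have "card R < card C" using insert by simp
    from insert.IH[OF insert.prems(1) this, of A] show ?thesis using True by auto
  next
    case False
    then obtain p where p: "p \<in> C" "A r p \<noteq> 0" by blast
    define C' where "C' = C - {p}"
    \<comment> \<open>Gaussian elimination of column \<open>p\<close> through row \<open>r\<close>:
      rows and columns both drop by one, so the inequality between the cardinalities
      survives.\<close>
    define A' where "A' = (\<lambda>i j. A i j - A i p * A r j / A r p)"
    have C': "finite C'" "card R < card C'" "p \<notin> C'" "C = insert p C'"
      using insert p by (auto simp: C'_def)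
    from insert.IH[OF C'(1,2), of A'] obtain u where u: "\<exists>j\<in>C'. u j \<noteq> 0"
        "\<forall>i\<in>R. (\<Sum>j\<in>C'. A' i j * u j) = 0" by blast
    define S where "S = (\<Sum>j\<in>C'. A r j * u j)"
    define w where "w = (\<lambda>j. if j = p then - S / A r p else u j)"
    have w: "(\<Sum>j\<in>C. A i j * w j) = (\<Sum>j\<in>C'. A i j * u j) - A i p * S / A r p" for i
    proof -
      have "(\<Sum>j\<in>C'. A i j * w j) = (\<Sum>j\<in>C'. A i j * u j)"
        using C' by (intro sum.cong) (auto simp: w_def)
      then show ?thesis using C' by (simp add: w_def)
    qed
    have "(\<Sum>j\<in>C. A i j * w j) = 0" if "i \<in> R" for i
    proof -
      have "0 = (\<Sum>j\<in>C'. A i j * u j - A i p / A r p * (A r j * u j))"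
        using u(2) that by (simp add: A'_def algebra_simps)
      also have "\<dots> = (\<Sum>j\<in>C'. A i j * u j) - A i p / A r p * S"
        by (simp add: sum_subtractf sum_distrib_left S_def)
      finally show ?thesis by (simp add: w)
    qed
    moreover have "(\<Sum>j\<in>C. A r j * w j) = 0"
      using p by (simp add: w S_def)
    moreover have "\<exists>j\<in>C. w j \<noteq> 0" using u(1) C' by (auto simp: w_def)
    ultimately show ?thesis by blast
  qed
qed

text \<open>With the right-hand side as an extra column \<open>None\<close> there are more columns
  than rows, so a nontrivial kernel vector exists. Its entry at \<open>None\<close> is nonzero, as
  otherwise \<open>A\<close> would have a nontrivial kernel; dividing by it solves the
  system.\<close>

lemma square_system_solvable:
  fixes A :: "'r \<Rightarrow> 'c \<Rightarrow> real"
  assumes fin: "finite R" "finite B" and card: "card B = card R"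
    and ker: "\<And>u. \<forall>i\<in>R. (\<Sum>j\<in>B. A i j * u j) = 0 \<Longrightarrow> \<forall>j\<in>B. u j = 0"
  obtains u where "\<And>j. j \<notin> B \<Longrightarrow> u j = 0" "\<And>i. i \<in> R \<Longrightarrow> (\<Sum>j\<in>B. A i j * u j) = b i"
proof -
  define C where "C = insert None (Some ` B)"
  define A' where "A' = (\<lambda>i. case_option (b i) (A i))"
  have C: "finite C" "card R < card C"
    using fin card by (auto simp: C_def card_image card_insert_if)
  have sumC: "(\<Sum>j\<in>C. A' i j * u j) = b i * u None + (\<Sum>j\<in>B. A i j * u (Some j))" for i u
    using fin by (simp add: C_def A'_def sum.reindex)
  obtain u where u: "\<exists>j\<in>C. u j \<noteq> 0" "\<forall>i\<in>R. (\<Sum>j\<in>C. A' i j * u j) = 0"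
    using homogeneous_system_nontrivial_solution[OF fin(1) C] by blast
  have N: "u None \<noteq> 0"
  proof
    assume z: "u None = 0"
    then have "\<forall>i\<in>R. (\<Sum>j\<in>B. A i j * u (Some j)) = 0" using u(2) by (simp add: sumC)
    from ker[OF this] u(1) z show False by (auto simp: C_def)
  qed
  show ?thesis
  proof (rule that[of "\<lambda>j. if j \<in> B then - u (Some j) / u None else 0"])
    fix i assume i: "i \<in> R"
    have "(\<Sum>j\<in>B. A i j * (if j \<in> B then - u (Some j) / u None else 0))
        = (\<Sum>j\<in>B. (A i j * u (Some j)) * (- 1 / u None))"
      by (intro sum.cong) auto
    also have "\<dots> = (\<Sum>j\<in>B. A i j * u (Some j)) * (- 1 / u None)" by (rule sum_distrib_right[symmetric])
    also have "(\<Sum>j\<in>B. A i j * u (Some j)) = - b i * u None" using u(2) i by (auto simp: sumC eq_neg_iff_add_eq_0 add.commute)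
    finally show "(\<Sum>j\<in>B. A i j * (if j \<in> B then - u (Some j) / u None else 0)) = b i" using N by simp
  qed auto
qed

text \<open>Solving \<open>A u = y\<close> turns the sum of squares of \<open>y\<close> into the
  pairing of \<open>y A\<close> with \<open>u\<close>, which is zero.\<close>

lemma square_left_kernel_trivial:
  fixes A :: "'r \<Rightarrow> 'c \<Rightarrow> real"
  assumes fin: "finite R" "finite B" and card: "card B = card R"
    and ker: "\<And>u. \<forall>i\<in>R. (\<Sum>j\<in>B. A i j * u j) = 0 \<Longrightarrow> \<forall>j\<in>B. u j = 0"
    and y: "\<forall>j\<in>B. (\<Sum>i\<in>R. y i * A i j) = 0"
  shows "\<forall>i\<in>R. y i = 0"
proof -
  obtain u where u: "\<And>i. i \<in> R \<Longrightarrow> (\<Sum>j\<in>B. A i j * u j) = y i"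
    using square_system_solvable[OF fin card ker] by metis
  have "(\<Sum>i\<in>R. (y i)\<^sup>2) = (\<Sum>i\<in>R. \<Sum>j\<in>B. y i * A i j * u j)"
    by (intro sum.cong refl) (simp add: u power2_eq_square mult.assoc flip: sum_distrib_left)
  also have "\<dots> = (\<Sum>j\<in>B. (\<Sum>i\<in>R. y i * A i j) * u j)"
    by (subst sum.swap) (simp add: sum_distrib_right)
  also have "\<dots> = 0" using y by simp
  finally show ?thesis using fin(1) by (simp add: sum_nonneg_eq_0_iff)
qed

text \<open>Bartl's algebraic proof: a point violating only the last constraint is used to eliminate it.\<close>

lemma Farkas:
  fixes a :: "'i \<Rightarrow> 'c \<Rightarrow> real" and c :: "'c \<Rightarrow> real"
  assumes finC: "finite C" and "finite I"
    and "\<And>d. \<forall>i\<in>I. (\<Sum>j\<in>C. a i j * d j) \<le> 0 \<Longrightarrow> (\<Sum>j\<in>C. c j * d j) \<le> 0"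
  shows "\<exists>l. (\<forall>i\<in>I. 0 \<le> l i) \<and> (\<forall>j\<in>C. c j = (\<Sum>i\<in>I. l i * a i j))"
  using assms(2,3)
proof (induction I arbitrary: a c rule: finite_induct)
  case empty
  have "(\<Sum>j\<in>C. c j * c j) \<le> 0" using empty by simp
  then have "(\<Sum>j\<in>C. c j * c j) = 0" by (simp add: antisym sum_nonneg)
  then show ?case using finC by (simp add: sum_nonneg_eq_0_iff)
next
  case (insert k I)
  let ?dot = "\<lambda>a d. (\<Sum>j\<in>C. a j * d j :: real)"
  show ?case
  proof (cases "\<forall>d. (\<forall>i\<in>I. ?dot (a i) d \<le> 0) \<longrightarrow> ?dot c d \<le> 0")
    case True
    then obtain l where l: "\<forall>i\<in>I. 0 \<le> l i" "\<forall>j\<in>C. c j = (\<Sum>i\<in>I. l i * a i j)"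
      using insert.IH[of a c] by blast
    have "(\<Sum>i\<in>I. (if i = k then 0 else l i) * a i j) = (\<Sum>i\<in>I. l i * a i j)" for j
      using insert.hyps by (intro sum.cong) auto
    then show ?thesis using l insert.hyps
      by (intro exI[of _ "\<lambda>i. if i = k then 0 else l i"]) auto
  next
    case False
    then obtain e where e: "\<forall>i\<in>I. ?dot (a i) e \<le> 0" "?dot c e > 0" by (auto simp: not_le)
    then have k: "?dot (a k) e > 0" using insert.prems[of e] by force
    \<comment> \<open>\<open>f b\<close> corrects \<open>b\<close> by a multiple of
      \<open>a k\<close> so that it vanishes at \<open>e\<close>. Dually, it is \<open>b\<close>
      composed with the projection along \<open>e\<close> onto the kernel of \<open>a k\<close>, so
      every direction tested below satisfies constraint \<open>k\<close> with equality.\<close>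
    define f where "f = (\<lambda>b :: 'c \<Rightarrow> real. \<lambda>j. b j - ?dot b e / ?dot (a k) e * a k j)"
    have f: "?dot (f b) d = ?dot b (\<lambda>j. d j - ?dot (a k) d / ?dot (a k) e * e j)" for b d
    proof -
      have "?dot (f b) d = ?dot b d - ?dot b e / ?dot (a k) e * ?dot (a k) d"
        unfolding f_def by (simp only: left_diff_distrib sum_subtractf sum_distrib_left mult.assoc)
      moreover have "?dot b (\<lambda>j. d j - ?dot (a k) d / ?dot (a k) e * e j)
          = ?dot b d - ?dot (a k) d / ?dot (a k) e * ?dot b e"
        by (simp only: right_diff_distrib sum_subtractf sum_distrib_left mult.left_commute)
      ultimately show ?thesis by simp
    qed
    have "?dot (f c) d \<le> 0" if "\<forall>i\<in>I. ?dot (f (a i)) d \<le> 0" for d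
    proof -
      have "?dot (a k) (\<lambda>j. d j - ?dot (a k) d / ?dot (a k) e * e j) = ?dot (f (a k)) d" by (rule f[symmetric])
      also have "\<dots> = 0" using k by (simp add: f_def)
      finally show ?thesis using that insert.prems unfolding f by simp
    qed
    then obtain l where l: "\<forall>i\<in>I. 0 \<le> l i" "\<forall>j\<in>C. f c j = (\<Sum>i\<in>I. l i * f (a i) j)"
      using insert.IH[of "\<lambda>i. f (a i)" "f c"] by blast
    \<comment> \<open>The coefficient of \<open>a k\<close> that the corrections removed. It is
      nonnegative because \<open>e\<close> satisfies all constraints of \<open>I\<close> while
      \<open>c\<close> and \<open>a k\<close> are positive at \<open>e\<close>.\<close>
    define m where "m = (?dot c e - (\<Sum>i\<in>I. l i * ?dot (a i) e)) / ?dot (a k) e"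
    have "(\<Sum>i\<in>I. l i * ?dot (a i) e) \<le> 0" using l(1) e(1) by (intro sum_nonpos) (simp add: mult_nonneg_nonpos)
    then have "m \<ge> 0" using e k by (simp add: m_def)
    moreover have "c j = (\<Sum>i\<in>I. l i * a i j) + m * a k j" if "j \<in> C" for j
    proof -
      have "(\<Sum>i\<in>I. l i * f (a i) j) = (\<Sum>i\<in>I. l i * a i j) - (\<Sum>i\<in>I. l i * ?dot (a i) e) / ?dot (a k) e * a k j"
        by (simp add: f_def algebra_simps sum_subtractf sum_divide_distrib sum_distrib_left)
      then show ?thesis using l(2) that by (simp add: f_def m_def diff_divide_distrib algebra_simps)
    qed
    moreover have "(\<Sum>i\<in>I. (if i = k then m else l i) * a i j) = (\<Sum>i\<in>I. l i * a i j)" for j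
      using insert.hyps by (intro sum.cong) auto
    ultimately show ?thesis using l(1) insert.hyps
      by (intro exI[of _ "\<lambda>i. if i = k then m else l i"]) auto
  qed
qed

section \<open>Pivots of the steepest-edge rule\<close>

locale standard_lp =
  fixes L :: "('r, 'c) std_form"
  assumes finite_rows: "finite (rows L)" and finite_cols: "finite (cols L)"
    and full_rank: "full_row_rank L"
begin

definition kernel :: "('c \<Rightarrow> real) set" where
  "kernel = {d. (\<forall>j. j \<notin> cols L \<longrightarrow> d j = 0) \<and>
     (\<forall>i\<in>rows L. (\<Sum>j\<in>cols L. mat_A L i j * d j) = 0)}"

lemma sum_cols_basis:
  assumes "B \<subseteq> cols L" "\<And>j. j \<notin> B \<Longrightarrow> x j = 0"
  shows "(\<Sum>j\<in>cols L. a j * x j) = (\<Sum>j\<in>B. a j * x j :: real)"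
  using assms finite_cols by (intro sum.mono_neutral_right) auto

lemma basisD:
  assumes "is_basis L B"
  shows "B \<subseteq> cols L" "finite B" "card B = card (rows L)"
    "\<And>u. \<forall>i\<in>rows L. (\<Sum>j\<in>B. mat_A L i j * u j) = 0 \<Longrightarrow> \<forall>j\<in>B. u j = 0"
  using assms finite_subset[OF _ finite_cols] by (auto simp: is_basis_def)

lemma basis_solvable:
  assumes "is_basis L B"
  obtains u where "\<And>j. j \<notin> B \<Longrightarrow> u j = 0" "\<And>i. i \<in> rows L \<Longrightarrow> (\<Sum>j\<in>B. mat_A L i j * u j) = b i"
  using square_system_solvable[OF finite_rows basisD(2)[OF assms] basisD(3)[OF assms], of "mat_A L" b]
    basisD(4)[OF assms] by blast

lemma basis_unique:
  assumes "is_basis L B"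
    and "\<And>j. j \<notin> B \<Longrightarrow> u j = 0" "\<And>j. j \<notin> B \<Longrightarrow> w j = 0"
    and "\<And>i. i \<in> rows L \<Longrightarrow> (\<Sum>j\<in>B. mat_A L i j * u j) = (\<Sum>j\<in>B. mat_A L i j * w j)"
  shows "u = w"
proof
  fix j
  have "\<forall>i\<in>rows L. (\<Sum>j\<in>B. mat_A L i j * (u j - w j)) = 0"
    using assms(4) by (simp add: right_diff_distrib sum_subtractf)
  from basisD(4)[OF assms(1) this] show "u j = w j" using assms(2,3) by (cases "j \<in> B") auto
qed

lemma basic_solution_eqI:
  assumes "is_basis L B" "x \<in> solutions L" "\<And>j. j \<notin> B \<Longrightarrow> x j = 0"
  shows "basic_solution L B = x"
  unfolding basic_solution_def
proof (rule the_equality)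
  fix y assume y: "y \<in> solutions L \<and> (\<forall>j. j \<notin> B \<longrightarrow> y j = 0)"
  have "(\<Sum>j\<in>B. mat_A L i j * y j) = (\<Sum>j\<in>B. mat_A L i j * x j)" if "i \<in> rows L" for i
    using y assms that sum_cols_basis[OF basisD(1)[OF assms(1)], of y "mat_A L i"]
      sum_cols_basis[OF basisD(1)[OF assms(1)], of x "mat_A L i"] by (auto simp: solutions_def)
  then show "y = x" using y assms by (intro basis_unique[OF assms(1)]) auto
qed (use assms in auto)

lemma basic_solution:
  assumes "is_basis L B"
  shows "basic_solution L B \<in> solutions L" "\<And>j. j \<notin> B \<Longrightarrow> basic_solution L B j = 0"
proof -
  obtain x where x: "\<And>j. j \<notin> B \<Longrightarrow> x j = 0" "\<And>i. i \<in> rows L \<Longrightarrow> (\<Sum>j\<in>B. mat_A L i j * x j) = vec_b L i"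
    by (rule basis_solvable[OF assms, of "vec_b L"]) blast
  have xs: "x \<in> solutions L"
    using x basisD(1)[OF assms] by (auto simp: solutions_def sum_cols_basis)
  show "basic_solution L B \<in> solutions L" "\<And>j. j \<notin> B \<Longrightarrow> basic_solution L B j = 0"
    using basic_solution_eqI[OF assms xs x(1)] xs x(1) by auto
qed

lemma basis_inv_col:
  assumes "is_basis L B"
  shows "\<And>j. j \<notin> B \<Longrightarrow> basis_inv_col L B q j = 0"
    "\<And>i. i \<in> rows L \<Longrightarrow> (\<Sum>j\<in>B. mat_A L i j * basis_inv_col L B q j) = mat_A L i q"
proof -
  obtain x where x: "\<And>j. j \<notin> B \<Longrightarrow> x j = 0" "\<And>i. i \<in> rows L \<Longrightarrow> (\<Sum>j\<in>B. mat_A L i j * x j) = mat_A L i q"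
    by (rule basis_solvable[OF assms, of "\<lambda>i. mat_A L i q"]) blast
  have "basis_inv_col L B q = x"
    unfolding basis_inv_col_def
  proof (rule the_equality)
    fix y assume "(\<forall>j. j \<notin> B \<longrightarrow> y j = 0) \<and> (\<forall>i\<in>rows L. (\<Sum>j\<in>B. mat_A L i j * y j) = mat_A L i q)"
    then show "y = x" using x by (intro basis_unique[OF assms, of y x]) simp_all
  qed (use x in auto)
  then show "\<And>j. j \<notin> B \<Longrightarrow> basis_inv_col L B q j = 0"
    "\<And>i. i \<in> rows L \<Longrightarrow> (\<Sum>j\<in>B. mat_A L i j * basis_inv_col L B q j) = mat_A L i q"
    using x by auto
qed

text \<open>\<open>y\<close> is row \<open>k\<close> of the inverse basis matrix. Coordinate
  \<open>k\<close> of the basic solution and of all edge directions is a pairing with this one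
  vector, so a description of its entries bounds both at once.\<close>

lemma dual_basis_vector:
  assumes B: "is_basis L B" and "k \<in> B"
  obtains y where "\<And>i. i \<notin> rows L \<Longrightarrow> y i = 0"
    "\<And>j. j \<in> B \<Longrightarrow> (\<Sum>i\<in>rows L. y i * mat_A L i j) = of_bool (j = k)"
    "\<And>x. x \<in> solutions L \<Longrightarrow> (\<And>j. j \<notin> B \<Longrightarrow> x j = 0) \<Longrightarrow> x k = (\<Sum>i\<in>rows L. y i * vec_b L i)"
    "\<And>q. edge_direction L B q k = - (\<Sum>i\<in>rows L. y i * mat_A L i q)"
proof -
  have ker: "\<forall>i\<in>rows L. y i = 0" if "\<forall>j\<in>B. (\<Sum>i\<in>rows L. mat_A L i j * y i) = 0" for y
    using square_left_kernel_trivial[OF finite_rows basisD(2,3)[OF B], of "mat_A L" y] basisD(4)[OF B] that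
    by (simp add: mult.commute)
  obtain y where y: "\<And>i. i \<notin> rows L \<Longrightarrow> y i = 0"
    "\<And>j. j \<in> B \<Longrightarrow> (\<Sum>i\<in>rows L. mat_A L i j * y i) = of_bool (j = k)"
    by (rule square_system_solvable[where A = "\<lambda>j i. mat_A L i j" and b = "\<lambda>j. of_bool (j = k)",
      OF basisD(2)[OF B] finite_rows basisD(3)[OF B, symmetric] ker]) auto
  have *: "(\<Sum>i\<in>rows L. y i * (\<Sum>j\<in>B. mat_A L i j * x j)) = x k" for x
  proof -
    have "(\<Sum>i\<in>rows L. y i * (\<Sum>j\<in>B. mat_A L i j * x j))
        = (\<Sum>j\<in>B. (\<Sum>i\<in>rows L. mat_A L i j * y i) * x j)"
      unfolding sum_distrib_left sum_distrib_right
      by (subst sum.swap) (intro sum.cong refl, simp)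
    also have "\<dots> = (\<Sum>j\<in>B. if j = k then x j else 0)" using y(2) by (intro sum.cong) auto
    also have "\<dots> = x k" using basisD(2)[OF B] \<open>k \<in> B\<close> by simp
    finally show ?thesis .
  qed
  show ?thesis
  proof (rule that[of y])
    fix x assume x: "x \<in> solutions L" "\<And>j. j \<notin> B \<Longrightarrow> x j = 0"
    then have "(\<Sum>j\<in>B. mat_A L i j * x j) = vec_b L i" if "i \<in> rows L" for i
      using sum_cols_basis[OF basisD(1)[OF B], of x "mat_A L i"] that by (auto simp: solutions_def)
    then show "x k = (\<Sum>i\<in>rows L. y i * vec_b L i)" using *[of x] by simp
  next
    fix q show "edge_direction L B q k = - (\<Sum>i\<in>rows L. y i * mat_A L i q)"
      using *[of "basis_inv_col L B q"] basis_inv_col(2)[OF B] \<open>k \<in> B\<close> by (simp add: edge_direction_def)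
  qed (use y in \<open>auto simp: mult.commute\<close>)
qed

lemma basis_dual_kernel:
  assumes B: "is_basis L B" and "\<forall>j\<in>B. (\<Sum>i\<in>rows L. y i * mat_A L i j) = 0"
  shows "\<forall>i\<in>rows L. y i = 0"
  using square_left_kernel_trivial[OF finite_rows basisD(2,3)[OF B], of "mat_A L" y] basisD(4)[OF B] assms(2)
  by blast

lemma edge_direction:
  assumes "is_basis L B" "q \<in> cols L - B"
  shows "edge_direction L B q \<in> kernel"
proof -
  have "(\<Sum>j\<in>cols L. mat_A L i j * edge_direction L B q j) = 0" if "i \<in> rows L" for i
  proof -
    have "(\<Sum>j\<in>cols L. mat_A L i j * edge_direction L B q j)
        = (\<Sum>j\<in>insert q B. mat_A L i j * edge_direction L B q j)"
      using assms basisD(1)[OF assms(1)] finite_cols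
      by (intro sum.mono_neutral_right) (auto simp: edge_direction_def)
    also have "\<dots> = mat_A L i q + (\<Sum>j\<in>B. mat_A L i j * edge_direction L B q j)"
      using assms basisD(2)[OF assms(1)] by (simp add: edge_direction_def)
    also have "(\<Sum>j\<in>B. mat_A L i j * edge_direction L B q j) = - (\<Sum>j\<in>B. mat_A L i j * basis_inv_col L B q j)"
      unfolding sum_negf[symmetric] by (intro sum.cong) (auto simp: edge_direction_def)
    also have "\<dots> = - mat_A L i q" using basis_inv_col(2)[OF assms(1) that] by simp
    finally show ?thesis by simp
  qed
  then show ?thesis using assms basisD(1)[OF assms(1)] by (auto simp: kernel_def edge_direction_def)
qed

text \<open>On the nonbasic columns the edge directions are unit vectors, which fixes the
  coefficients; agreement on \<open>B\<close> follows since the basis columns are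
  independent.\<close>

lemma kernel_eq_sum_edge_directions:
  assumes B: "is_basis L B" and d: "d \<in> kernel"
  shows "d j = (\<Sum>q\<in>cols L - B. d q * edge_direction L B q j)"
proof -
  let ?N = "cols L - B"
  define w where "w = (\<lambda>j. if j \<in> B then \<Sum>q\<in>?N. d q * edge_direction L B q j else 0)"
  have fin: "finite ?N" using finite_cols by simp
  have split: "(\<Sum>j\<in>cols L. f j) = (\<Sum>j\<in>B. f j) + (\<Sum>j\<in>?N. f j)" for f :: "'c \<Rightarrow> real"
    using sum.subset_diff[OF basisD(1)[OF B] finite_cols, of f] by simp
  have eqN: "(\<Sum>j\<in>?N. mat_A L i j * edge_direction L B q j) = mat_A L i q" if "q \<in> ?N" for i q
  proof -
    have "(\<Sum>j\<in>?N. mat_A L i j * edge_direction L B q j) = (\<Sum>j\<in>?N. if j = q then mat_A L i q else 0)"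
      by (intro sum.cong) (auto simp: edge_direction_def)
    then show ?thesis using fin that by simp
  qed
  have "(\<Sum>j\<in>B. mat_A L i j * d j) = (\<Sum>j\<in>B. mat_A L i j * w j)" if i: "i \<in> rows L" for i
  proof -
    have e: "(\<Sum>j\<in>B. mat_A L i j * edge_direction L B q j) = - mat_A L i q" if "q \<in> ?N" for q
    proof -
      have "(\<Sum>j\<in>cols L. mat_A L i j * edge_direction L B q j) = 0"
        using edge_direction[OF B that] i by (simp add: kernel_def)
      then show ?thesis using eqN[OF that] by (simp add: split eq_neg_iff_add_eq_0)
    qed
    have "(\<Sum>j\<in>B. mat_A L i j * w j) = (\<Sum>j\<in>B. \<Sum>q\<in>?N. d q * (mat_A L i j * edge_direction L B q j))"
      by (intro sum.cong) (auto simp: w_def sum_distrib_left mult.left_commute)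
    also have "\<dots> = (\<Sum>q\<in>?N. d q * (\<Sum>j\<in>B. mat_A L i j * edge_direction L B q j))"
      by (subst sum.swap) (simp add: sum_distrib_left)
    also have "\<dots> = - (\<Sum>q\<in>?N. mat_A L i q * d q)"
      unfolding sum_negf[symmetric] by (intro sum.cong) (auto simp: e)
    also have "\<dots> = (\<Sum>j\<in>B. mat_A L i j * d j)"
      using d i split[of "\<lambda>j. mat_A L i j * d j"] by (simp add: kernel_def)
    finally show ?thesis by simp
  qed
  then have "\<forall>i\<in>rows L. (\<Sum>j\<in>B. mat_A L i j * (d j - w j)) = 0"
    by (simp add: right_diff_distrib sum_subtractf)
  then have eqw: "d j = w j" if "j \<in> B" for j using basisD(4)[OF B] that by force
  show ?thesis
  proof (cases "j \<in> B")
    case True then show ?thesis using eqw by (simp add: w_def)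
  next
    case False
    then have "(\<Sum>q\<in>?N. d q * edge_direction L B q j) = (\<Sum>q\<in>?N. if q = j then d j else 0)"
      by (intro sum.cong) (auto simp: edge_direction_def)
    then show ?thesis using False fin d by (simp add: kernel_def)
  qed
qed

lemma solutions_diff_kernel:
  assumes "x \<in> solutions L" "y \<in> solutions L"
  shows "(\<lambda>j. x j - y j) \<in> kernel"
  using assms by (auto simp: solutions_def kernel_def right_diff_distrib sum_subtractf)

lemma objective_diff_basis:
  assumes B: "is_basis L B" and x: "x \<in> solutions L"
  shows "objective L c x - objective L c (basic_solution L B) = (\<Sum>q\<in>cols L - B. x q * reduced_cost L c B q)"
proof -
  let ?d = "\<lambda>j. x j - basic_solution L B j"
  have d: "?d \<in> kernel" using solutions_diff_kernel[OF x basic_solution(1)[OF B]] .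
  have "objective L c x - objective L c (basic_solution L B) = (\<Sum>j\<in>cols L. c j * ?d j)"
    by (simp add: objective_def right_diff_distrib sum_subtractf)
  also have "\<dots> = (\<Sum>j\<in>cols L. c j * (\<Sum>q\<in>cols L - B. ?d q * edge_direction L B q j))"
    by (subst (1) kernel_eq_sum_edge_directions[OF B d]) (rule refl)
  also have "\<dots> = (\<Sum>j\<in>cols L. \<Sum>q\<in>cols L - B. x q * (c j * edge_direction L B q j))"
    using basic_solution(2)[OF B]
    by (intro sum.cong refl) (auto simp: sum_distrib_left mult.left_commute intro!: sum.cong)
  also have "\<dots> = (\<Sum>q\<in>cols L - B. x q * reduced_cost L c B q)"
    by (subst sum.swap) (simp add: reduced_cost_def objective_def sum_distrib_left)
  finally show ?thesis .
qed

lemma edge_direction_norm_pos: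
  assumes "q \<in> cols L - B"
  shows "0 < L2_set (edge_direction L B q) (cols L)"
proof -
  have "edge_direction L B q q = 1" using assms by (simp add: edge_direction_def)
  then have "L2_set (edge_direction L B q) (cols L) \<noteq> 0"
    using assms finite_cols by (subst L2_set_eq_0_iff) (auto intro!: bexI[of _ q])
  then show ?thesis using L2_set_nonneg[of "edge_direction L B q" "cols L"] by linarith
qed

lemma pivot_step:
  assumes fb: "feasible_basis L B" and q: "q \<in> cols L - B" and r: "ratio_test_leaving L B q p"
    and B': "B' = insert q (B - {p})"
  defines "\<theta> \<equiv> basic_solution L B p / - edge_direction L B q p"
  shows "feasible_basis L B'" "\<theta> \<ge> 0"
    "basic_solution L B' = (\<lambda>j. basic_solution L B j + \<theta> * edge_direction L B q j)"
proof -
  let ?x = "basic_solution L B" and ?e = "edge_direction L B q"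
  define x' where "x' = (\<lambda>j. ?x j + \<theta> * ?e j)"
  have B: "is_basis L B" and xf: "?x \<in> feasible_set L" using fb by (auto simp: feasible_basis_def)
  have p: "p \<in> B" "?e p < 0" and min: "\<And>k. k \<in> B \<Longrightarrow> ?e k < 0 \<Longrightarrow> \<theta> \<le> ?x k / - ?e k"
    using r by (auto simp: ratio_test_leaving_def \<theta>_def)
  have x0: "?x j \<ge> 0" for j using xf by (cases "j \<in> cols L") (auto simp: feasible_set_def solutions_def)
  show \<theta>0: "\<theta> \<ge> 0" unfolding \<theta>_def using p x0[of p] by (intro divide_nonneg_pos) auto
  have e: "?e \<in> kernel" by (rule edge_direction[OF B q])
  have sol: "x' \<in> solutions L"
    using e xf by (auto simp: x'_def solutions_def feasible_set_def kernel_def distrib_left sum.distrib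
      mult.left_commute simp flip: sum_distrib_left)
  have nonneg: "x' j \<ge> 0" for j
  proof (cases "?e j < 0")
    case True
    then have j: "j \<in> B" by (auto simp: edge_direction_def split: if_splits)
    have "\<theta> * - ?e j \<le> ?x j" by (rule pos_le_divide_eq[THEN iffD1, OF _ min[OF j True]]) (use True in simp)
    then show ?thesis by (simp add: x'_def)
  next
    case False then show ?thesis using x0[of j] \<theta>0 by (simp add: x'_def)
  qed
  have z: "x' j = 0" if "j \<notin> B'" for j
  proof (cases "j = p")
    case True then show ?thesis using p by (simp add: x'_def \<theta>_def)
  next
    case False
    then have "j \<notin> B" "j \<noteq> q" using that B' by auto
    then show ?thesis using basic_solution(2)[OF B] by (simp add: x'_def edge_direction_def)
  qed
  have bas: "is_basis L B'"
    unfolding is_basis_def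
  proof (intro conjI allI impI)
    show "B' \<subseteq> cols L" using basisD(1)[OF B] q B' by auto
    have "card B' = Suc (card (B - {p}))"
      using B' q basisD(2)[OF B] by simp
    also have "\<dots> = card B" using card_Suc_Diff1[OF basisD(2)[OF B] p(1)] .
    finally show "card B' = card (rows L)" using basisD(3)[OF B] by simp
    fix u assume u: "\<forall>i\<in>rows L. (\<Sum>j\<in>B'. mat_A L i j * u j) = 0"
    define w where "w = (\<lambda>j. if j \<in> B' then u j else 0)"
    have "(\<Sum>j\<in>cols L. mat_A L i j * w j) = (\<Sum>j\<in>B'. mat_A L i j * u j)" for i
      using \<open>B' \<subseteq> cols L\<close> finite_cols by (intro sum.mono_neutral_cong_right) (auto simp: w_def)
    then have wk: "w \<in> kernel" using u \<open>B' \<subseteq> cols L\<close> by (auto simp: kernel_def w_def)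
    \<comment> \<open>With respect to \<open>B\<close>, a kernel vector supported on
      \<open>B'\<close> has \<open>q\<close> as its only possible nonbasic coordinate, so it is a
      multiple of the edge direction. It vanishes at \<open>p\<close>, where the direction is
      negative, so the multiple is zero.\<close>
    have wq: "w k = w q * ?e k" for k
    proof -
      have "w k = (\<Sum>s\<in>cols L - B. w s * edge_direction L B s k)"
        by (rule kernel_eq_sum_edge_directions[OF B wk])
      also have "\<dots> = (\<Sum>s\<in>cols L - B. if s = q then w q * ?e k else 0)"
        using B' by (intro sum.cong) (auto simp: w_def)
      also have "\<dots> = w q * ?e k" using q finite_cols by simp
      finally show ?thesis .
    qed
    have "w p = 0" using B' p q by (auto simp: w_def)
    then have "w q = 0" using wq[of p] p by auto
    then have "w k = 0" for k using wq[of k] by simp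
    then show "\<forall>j\<in>B'. u j = 0" by (metis w_def)
  qed
  show eq: "basic_solution L B' = (\<lambda>j. ?x j + \<theta> * ?e j)"
    using basic_solution_eqI[OF bas sol z] by (simp add: x'_def)
  show "feasible_basis L B'"
    using bas sol nonneg eq by (auto simp: feasible_basis_def feasible_set_def x'_def)
qed

lemma steepest_edge_pivot_progress:
  assumes fb: "feasible_basis L B" and piv: "steepest_edge_pivot L c B B'"
    and norm: "\<And>q. q \<in> cols L - B \<Longrightarrow> L2_set (edge_direction L B q) (cols L) \<le> h"
    and z: "z \<in> feasible_set L" "(\<Sum>j\<in>cols L. z j) \<le> s"
    and "0 \<le> d" and d: "L2_set (\<lambda>j. basic_solution L B' j - basic_solution L B j) (cols L) \<ge> d"
  shows "d * (objective L c (basic_solution L B) - objective L c z)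
      \<le> h * s * (objective L c (basic_solution L B) - objective L c (basic_solution L B'))" (is ?A)
    "basic_solution L B' \<noteq> basic_solution L B \<Longrightarrow>
      objective L c (basic_solution L B') < objective L c (basic_solution L B)"
proof -
  obtain q p where se: "steepest_edge_entering L c B q" and r: "ratio_test_leaving L B q p"
    and B': "B' = insert q (B - {p})" using piv by (auto simp: steepest_edge_pivot_def)
  let ?x = "basic_solution L B" and ?x' = "basic_solution L B'" and ?e = "edge_direction L B q"
  let ?n = "\<lambda>q. L2_set (edge_direction L B q) (cols L)"
  define \<sigma> where "\<sigma> = steepness L c B q"
  define \<theta> where "\<theta> = basic_solution L B p / - edge_direction L B q p"
  have q: "q \<in> cols L - B" and \<sigma>: "\<sigma> < 0" and min: "\<And>t. t \<in> cols L - B \<Longrightarrow> \<sigma> \<le> steepness L c B t"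
    using se by (auto simp: steepest_edge_entering_def \<sigma>_def)
  note step = pivot_step[OF fb q r B', folded \<theta>_def]
  have B: "is_basis L B" using fb by (simp add: feasible_basis_def)
  have rc: "reduced_cost L c B q = \<sigma> * ?n q"
    using edge_direction_norm_pos[OF q] by (simp add: \<sigma>_def steepness_def)
  have dec: "objective L c ?x - objective L c ?x' = - \<sigma> * (\<theta> * ?n q)"
  proof -
    have "objective L c ?x' = objective L c ?x + \<theta> * reduced_cost L c B q"
      by (simp add: step(3) objective_def reduced_cost_def distrib_left sum.distrib sum_distrib_left mult.left_commute)
    then show ?thesis by (simp add: rc)
  qed
  \<comment> \<open>Together with \<open>dec\<close>: the objective falls by exactly
    \<open>- \<sigma>\<close> times the Euclidean length of the step. This is what dividing reduced
    costs by edge norms buys.\<close>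
  have len: "L2_set (\<lambda>j. ?x' j - ?x j) (cols L) = \<theta> * ?n q"
    using step(2) by (simp add: step(3) L2_set_left_distrib L2_set_right_distrib)
  have "objective L c z - objective L c ?x = (\<Sum>t\<in>cols L - B. z t * reduced_cost L c B t)"
    using objective_diff_basis[OF B] z(1) by (simp add: feasible_set_def)
  also have "\<dots> \<ge> (\<Sum>t\<in>cols L - B. z t * (\<sigma> * h))"
  proof (rule sum_mono)
    fix t assume t: "t \<in> cols L - B"
    have "\<sigma> * h \<le> \<sigma> * ?n t" using norm[OF t] \<sigma> by simp
    also have "\<dots> \<le> reduced_cost L c B t"
      using min[OF t] edge_direction_norm_pos[OF t] by (simp add: steepness_def pos_le_divide_eq)
    finally show "z t * (\<sigma> * h) \<le> z t * reduced_cost L c B t"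
      using z(1) t by (intro mult_left_mono) (auto simp: feasible_set_def)
  qed
  also have "(\<Sum>t\<in>cols L - B. z t * (\<sigma> * h)) = (\<sigma> * h) * (\<Sum>t\<in>cols L - B. z t)"
    by (simp add: sum_distrib_left mult.commute)
  finally have 1: "objective L c ?x - objective L c z \<le> (-\<sigma> * h) * (\<Sum>t\<in>cols L - B. z t)" by simp
  have h: "h > 0" using norm[OF q] edge_direction_norm_pos[OF q] by linarith
  have "(\<Sum>t\<in>cols L - B. z t) \<le> (\<Sum>t\<in>cols L. z t)"
    using finite_cols z(1) by (intro sum_mono2) (auto simp: feasible_set_def)
  then have "(-\<sigma> * h) * (\<Sum>t\<in>cols L - B. z t) \<le> (-\<sigma> * h) * s"
    using z(2) \<sigma> h by (intro mult_left_mono) (auto simp: mult_nonneg_nonpos2 mult_nonpos_nonneg)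
  with 1 have gap: "objective L c ?x - objective L c z \<le> (-\<sigma> * h) * s" by linarith
  have s: "0 \<le> s" using z sum_nonneg[of "cols L" z] by (force simp: feasible_set_def)
  have "d * (objective L c ?x - objective L c z) \<le> d * ((-\<sigma> * h) * s)"
    using gap \<open>0 \<le> d\<close> by (rule mult_left_mono)
  also have "\<dots> \<le> (\<theta> * ?n q) * ((-\<sigma> * h) * s)"
    using d len \<sigma> h s by (intro mult_right_mono) (auto intro!: mult_nonneg_nonneg mult_nonpos_nonneg)
  finally show ?A by (simp add: dec mult_ac)
  show "?x' \<noteq> ?x \<Longrightarrow> objective L c ?x' < objective L c ?x"
  proof -
    assume "?x' \<noteq> ?x"
    then have "\<theta> \<noteq> 0" using step(3) by auto
    then have "\<theta> > 0" using step(2) by simp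
    then have "\<sigma> * (\<theta> * ?n q) < 0" using \<sigma> edge_direction_norm_pos[OF q] by (simp add: mult_neg_pos)
    then show ?thesis using dec by simp
  qed
qed

end

section \<open>Elimination of coordinates\<close>

text \<open>The run is abstracted to a sequence of points whose weighted sum shrinks at every
  change. Nothing is assumed about repeated points, so degenerate pivots cost nothing.\<close>

lemma distinct_values_bound:
  fixes x :: "nat \<Rightarrow> 'c \<Rightarrow> real" and S :: "'c \<Rightarrow> real"
  assumes "finite J" and S: "\<And>j. j \<in> J \<Longrightarrow> S j > 0"
    and x0: "\<And>t j. t \<le> n \<Longrightarrow> j \<in> J \<Longrightarrow> x t j \<ge> 0"
    and gap: "\<And>t j. t \<le> n \<Longrightarrow> j \<in> J \<Longrightarrow> x t j > 0 \<Longrightarrow> x t j \<ge> \<delta>"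
    and sum: "\<And>t. t \<le> n \<Longrightarrow> (\<Sum>j\<in>J. x t j) \<le> s"
    and step: "\<And>t. t < n \<Longrightarrow> x (Suc t) \<noteq> x t \<Longrightarrow>
        (\<Sum>j\<in>J. S j * x (Suc t) j) < r * (\<Sum>j\<in>J. S j * x t j)"
    and r: "0 < r" "r \<le> 1" and K: "K \<ge> 1" "r ^ K * s \<le> \<delta>"
  shows "card (x ` {..n}) \<le> card J * K + 1"
proof -
  define v where "v = (\<lambda>t. \<Sum>j\<in>J. S j * x t j)"
  \<comment> \<open>\<open>m t\<close> counts the changes before time \<open>t\<close> and serves as
    the clock. \<open>W t\<close> looks ahead to all times from \<open>t\<close> to
    \<open>n\<close>: a coordinate may vanish and return, but \<open>W\<close> can only
    shrink.\<close>
  define m where "m = (\<lambda>t. card {u. u < t \<and> x (Suc u) \<noteq> x u})"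
  define W where "W = (\<lambda>t. {j \<in> J. \<exists>u. t \<le> u \<and> u \<le> n \<and> x u j > 0})"
  have v0: "v t \<ge> 0" if "t \<le> n" for t
    unfolding v_def using x0[OF that] S by (intro sum_nonneg) (simp add: less_imp_le)
  have m0: "m 0 = 0" by (simp add: m_def)
  have mS: "m (Suc t) = m t + of_bool (x (Suc t) \<noteq> x t)" for t
  proof -
    have "{u. u < Suc t \<and> x (Suc u) \<noteq> x u} =
        (if x (Suc t) \<noteq> x t then insert t {u. u < t \<and> x (Suc u) \<noteq> x u} else {u. u < t \<and> x (Suc u) \<noteq> x u})"
      by (auto simp: less_Suc_eq)
    then show ?thesis by (simp add: m_def)
  qed
  have card_le: "card (x ` {..t}) \<le> m t + 1" for t
  proof (induction t)
    case (Suc t)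
    have eq: "x ` {..Suc t} = insert (x (Suc t)) (x ` {..t})" by (simp add: atMost_Suc)
    show ?case
    proof (cases "x (Suc t) = x t")
      case True
      then have "x ` {..Suc t} = x ` {..t}" using eq by auto
      then show ?thesis using Suc mS[of t] True by simp
    next
      case False
      have "card (x ` {..Suc t}) \<le> Suc (card (x ` {..t}))" unfolding eq by (simp add: card_insert_if)
      then show ?thesis using Suc mS[of t] False by simp
    qed
  qed simp
  have attained: "\<exists>t\<le>u. m t = i" if "i \<le> m u" for i u
    using that
  proof (induction u)
    case 0 then show ?case by (simp add: m0)
  next
    case (Suc u)
    show ?case
    proof (cases "i \<le> m u")
      case True then show ?thesis using Suc.IH le_SucI by blast
    next
      case False
      then have "i = m (Suc u)" using Suc.prems mS[of u] by (cases "x (Suc u) = x u") auto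
      then show ?thesis by blast
    qed
  qed
  \<comment> \<open>The strict part is needed twice: it excludes the borderline case
    \<open>r ^ K * s = \<delta>\<close>, and it forbids any change once \<open>v\<close> is
    zero.\<close>
  have decay: "m t \<le> m u \<and> v u \<le> r ^ (m u - m t) * v t \<and> (m t < m u \<longrightarrow> v u < r ^ (m u - m t) * v t)"
    if "t \<le> u" "u \<le> n" for t u
    using that
  proof (induction u rule: dec_induct)
    case base show ?case by simp
  next
    case (step u)
    show ?case
    proof (cases "x (Suc u) = x u")
      case True
      then have "v (Suc u) = v u" by (simp add: v_def)
      then show ?thesis using step mS[of u] True by simp
    next
      case False
      then have e: "m (Suc u) = Suc (m u)" using mS[of u] by simp
      have "v (Suc u) < r * v u" unfolding v_def using assms(6)[of u] step False by simp
      also have "\<dots> \<le> r * (r ^ (m u - m t) * v t)" using step r by (intro mult_left_mono) auto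
      finally have "v (Suc u) < r ^ (m (Suc u) - m t) * v t" using step e by (simp add: Suc_diff_le)
      then show ?thesis using step e by simp
    qed
  qed
  have shrink: "card (W u) < card (W t)" if tu: "t \<le> u" "u \<le> n" "m u \<ge> m t + K" for t u
  proof -
    have sub: "W w \<subseteq> W t" "W w \<subseteq> J" if "t \<le> w" for w
      using order_trans[OF that] by (fastforce simp: W_def)+
    have mlt: "m t < m u" using tu K by simp
    have strict: "v w < r ^ K * v t" if "u \<le> w" "w \<le> n" for w
    proof -
      have mw: "m u \<le> m w" using decay[of u w] that by simp
      have "v w < r ^ (m w - m t) * v t" using decay[of t w] that tu mlt mw by simp
      also have "\<dots> \<le> r ^ K * v t"
        using tu mw r v0[of t] by (intro mult_right_mono power_decreasing) auto
      finally show ?thesis .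
    qed
    have vt: "v t > 0"
    proof -
      have "0 < r ^ K * v t" using strict[of u] v0[of u] tu by simp
      then show ?thesis using r by (simp add: zero_less_mult_iff)
    qed
    define P where "P = {j\<in>J. x t j > 0}"
    have P: "finite P" "P \<subseteq> J" using \<open>finite J\<close> by (auto simp: P_def)
    have vP: "v t = (\<Sum>j\<in>P. S j * x t j)"
      unfolding v_def using \<open>finite J\<close> x0[of t] tu
      by (intro sum.mono_neutral_right) (force simp: P_def)+
    have "P \<noteq> {}" using vt vP by auto
    then obtain k where k: "k \<in> P" "\<And>j. j \<in> P \<Longrightarrow> S j \<le> S k"
      using Max_in[of "S ` P"] Max_ge[of "S ` P"] P(1) by fastforce
    have "v t \<le> (\<Sum>j\<in>P. S k * x t j)" unfolding vP
      using k by (intro sum_mono mult_right_mono) (auto simp: P_def)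
    also have "\<dots> \<le> S k * (\<Sum>j\<in>J. x t j)"
      unfolding sum_distrib_left[symmetric] using P \<open>finite J\<close> S[of k] k x0[of t] tu
      by (intro mult_left_mono sum_mono2) auto
    also have "\<dots> \<le> S k * s" using sum[of t] tu S[of k] k P by (intro mult_left_mono) auto
    finally have vs: "v t \<le> S k * s" .
    have kJ: "k \<in> J" using k P by auto
    have "x w k = 0" if w: "u \<le> w" "w \<le> n" for w
    proof (rule ccontr)
      assume "x w k \<noteq> 0"
      then have "x w k \<ge> \<delta>" using gap[of w k] x0[of w k] kJ w by force
      then have "S k * \<delta> \<le> S k * x w k" using S[OF kJ] by simp
      also have "\<dots> \<le> v w" unfolding v_def using kJ \<open>finite J\<close> w x0[of w] S
        by (intro member_le_sum) (auto simp: less_imp_le)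
      also have "\<dots> < r ^ K * v t" using strict w by simp
      also have "\<dots> \<le> r ^ K * (S k * s)" using vs r by simp
      also have "\<dots> = S k * (r ^ K * s)" by simp
      also have "\<dots> \<le> S k * \<delta>" using K S[OF kJ] by simp
      finally show False by simp
    qed
    then have "k \<notin> W u" by (fastforce simp: W_def)
    moreover have "k \<in> W t" using k tu kJ by (auto simp: W_def P_def)
    ultimately have "W u \<subset> W t" using sub[of u] tu by auto
    then show ?thesis using \<open>finite J\<close> sub(2)[of t] by (intro psubset_card_mono) (auto intro: finite_subset)
  qed
  have rounds: "card (W t) + i \<le> card J" if "t \<le> n" "m t \<ge> i * K" for t i
    using that
  proof (induction i arbitrary: t)
    case 0
    have "W t \<subseteq> J" by (auto simp: W_def)
    then show ?case using \<open>finite J\<close> by (simp add: card_mono)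
  next
    case (Suc i)
    obtain t0 where t0: "t0 \<le> t" "m t0 = i * K" using attained[of "i * K" t] Suc.prems by auto
    have "card (W t0) + i \<le> card J" using Suc.IH[of t0] t0 Suc.prems by simp
    moreover have "card (W t) < card (W t0)" using shrink[of t0 t] t0 Suc.prems by simp
    ultimately show ?case by simp
  qed
  \<comment> \<open>After \<open>card J * K\<close> changes \<open>W\<close> is empty, so
    \<open>v\<close> is zero; one more change would make \<open>v\<close> negative.\<close>
  have "m n \<le> card J * K"
  proof (rule ccontr)
    assume "\<not> m n \<le> card J * K"
    then obtain t where t: "t \<le> n" "m t = card J * K" "m t < m n" using attained[of "card J * K" n] by auto
    then have "card (W t) = 0" using rounds[of t "card J"] by simp
    moreover have "W t \<subseteq> J" by (auto simp: W_def)
    ultimately have "W t = {}" using \<open>finite J\<close> finite_subset[of "W t" J] by auto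
    then have "x t j = 0" if "j \<in> J" for j using that t x0[of t j] by (force simp: W_def)
    then have "v t = 0" by (simp add: v_def)
    then show False using decay[of t n] t v0[of n] by simp
  qed
  then show ?thesis using card_le[of n] by simp
qed

section \<open>Existence of an optimum and of dual slacks with many zeros\<close>

context standard_lp
begin

lemma closed_feasible_set: "closed (feasible_set L)"
proof -
  have "feasible_set L = {x. (\<forall>j. j \<notin> cols L \<longrightarrow> x j = 0) \<and>
     (\<forall>i. i \<in> rows L \<longrightarrow> (\<Sum>j\<in>cols L. mat_A L i j * x j) = vec_b L i) \<and> (\<forall>j. j \<in> cols L \<longrightarrow> 0 \<le> x j)}"
    by (auto simp: feasible_set_def solutions_def)
  also have "closed \<dots>"
    by (intro closed_Collect_conj closed_Collect_all closed_Collect_imp open_Collect_const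
        closed_Collect_eq closed_Collect_le continuous_intros continuous_on_product_coordinates)
  finally show ?thesis .
qed

lemma objective_attains_minimum:
  assumes ne: "feasible_set L \<noteq> {}" and s: "\<And>x. x \<in> feasible_set L \<Longrightarrow> (\<Sum>j\<in>cols L. x j) \<le> s"
  obtains z where "z \<in> feasible_set L" "\<And>x. x \<in> feasible_set L \<Longrightarrow> objective L c z \<le> objective L c x"
proof -
  \<comment> \<open>Points are functions on a type that may be infinite. In the product topology,
    the box with factor \<open>{0}\<close> outside the columns is still compact.\<close>
  define Q :: "('c \<Rightarrow> real) set" where "Q = PiE UNIV (\<lambda>j. if j \<in> cols L then {0..s} else {0})"
  have "compactin (product_topology (\<lambda>_. euclideanreal) UNIV) Q"
    unfolding Q_def by (subst compactin_PiE) auto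
  then have "compact Q" by (simp add: euclidean_product_topology)
  moreover have "feasible_set L \<subseteq> Q"
  proof
    fix x assume x: "x \<in> feasible_set L"
    have "x j \<le> s" if "j \<in> cols L" for j
      using member_le_sum[of j "cols L" x] that finite_cols x s[OF x] by (auto simp: feasible_set_def)
    then show "x \<in> Q" using x by (auto simp: Q_def feasible_set_def solutions_def)
  qed
  ultimately have "compact (feasible_set L)"
    using closed_feasible_set by (metis closed_Int_compact inf.absorb_iff1)
  moreover have "continuous_on (feasible_set L) (objective L c)"
    unfolding objective_def
    by (intro continuous_intros continuous_on_subset[OF continuous_on_product_coordinates]) auto
  ultimately show ?thesis using that continuous_attains_inf[of "feasible_set L" "objective L c"] ne by blast
qed

text \<open>Farkas' lemma for the directions feasible at \<open>z\<close> gives slacks complementary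
  to \<open>z\<close>. Among all of these, one with the most zeros has at least as many zeros as
  there are rows: otherwise some combination of rows vanishing at its zeros could be added until a
  further slack reaches zero. This is the passage to a vertex of the dual optimal face, and
  \<open>z\<close> itself may be any optimal point.\<close>

lemma optimal_dual:
  assumes z: "z \<in> feasible_set L" and opt: "\<And>x. x \<in> feasible_set L \<Longrightarrow> objective L c z \<le> objective L c x"
  obtains S where "\<And>j. j \<in> cols L \<Longrightarrow> S j \<ge> 0"
    "\<And>x. x \<in> solutions L \<Longrightarrow> objective L c x - objective L c z = (\<Sum>j\<in>cols L. S j * x j)"
    "card {j \<in> cols L. S j > 0} + card (rows L) \<le> card (cols L)"
proof -
  define D where "D = (\<lambda>S. (\<forall>j\<in>cols L. S j \<ge> 0 \<and> (z j \<noteq> 0 \<longrightarrow> S j = 0)) \<and>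
      (\<exists>\<pi>. \<forall>j\<in>cols L. c j = S j + (\<Sum>i\<in>rows L. \<pi> i * mat_A L i j)))"
  have "\<exists>S. D S"
  proof -
    \<comment> \<open>Index \<open>Inl l\<close> demands \<open>d l \<ge> 0\<close>; the two indices
      \<open>Inr (i, b)\<close> are opposite inequalities that together form equation
      \<open>i\<close>.\<close>
    define a where "a = (\<lambda>k j. case k of Inl l \<Rightarrow> - of_bool (j = l) |
        Inr (i, b) \<Rightarrow> (if b then 1 else -1) * mat_A L i j)"
    define Z where "Z = {j \<in> cols L. z j = 0}"
    define I where "I = Inl ` Z \<union> Inr ` (rows L \<times> (UNIV :: bool set))"
    have finI: "finite I" "finite Z" using finite_rows finite_cols by (auto simp: I_def Z_def)
    have "(\<Sum>j\<in>cols L. - c j * d j) \<le> 0" if d: "\<forall>k\<in>I. (\<Sum>j\<in>cols L. a k j * d j) \<le> 0" for d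
    proof -
      have dZ: "d l \<ge> 0" if "l \<in> Z" for l
      proof -
        have "(\<Sum>j\<in>cols L. a (Inl l) j * d j) = (\<Sum>j\<in>cols L. if j = l then - d j else 0)"
          by (intro sum.cong) (auto simp: a_def)
        then have "(\<Sum>j\<in>cols L. a (Inl l) j * d j) = - d l" using that finite_cols by (simp add: Z_def)
        moreover have "(\<Sum>j\<in>cols L. a (Inl l) j * d j) \<le> 0"
          by (rule bspec[OF d]) (use that in \<open>simp add: I_def\<close>)
        ultimately show ?thesis by simp
      qed
      have dA: "(\<Sum>j\<in>cols L. mat_A L i j * d j) = 0" if "i \<in> rows L" for i
      proof -
        have "(\<Sum>j\<in>cols L. a (Inr (i, b)) j * d j) \<le> 0" for b
          by (rule bspec[OF d]) (use that in \<open>simp add: I_def\<close>)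
        from this[of True] this[of False] show ?thesis by (simp add: a_def sum_negf)
      qed
      \<comment> \<open>The largest step up to 1 for which \<open>z + \<epsilon> d\<close> stays
        nonnegative; the 1 keeps the set nonempty. It is positive because \<open>d\<close> is
        negative only where \<open>z\<close> is positive.\<close>
      define \<epsilon> where "\<epsilon> = Min (insert 1 ((\<lambda>j. z j / - d j) ` {j \<in> cols L. d j < 0}))"
      have fin: "finite (insert 1 ((\<lambda>j. z j / - d j) ` {j \<in> cols L. d j < 0}))" using finite_cols by simp
      have z0: "z j \<ge> 0" if "j \<in> cols L" for j using z that by (simp add: feasible_set_def)
      have "\<epsilon> > 0"
        unfolding \<epsilon>_def
      proof (subst Min_gr_iff[OF fin], simp, intro ballI)
        fix q assume "q \<in> insert 1 ((\<lambda>j. z j / - d j) ` {j \<in> cols L. d j < 0})"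
        moreover have "z j / - d j > 0" if "j \<in> cols L" "d j < 0" for j
        proof -
          have "z j \<noteq> 0" using dZ[of j] that by (auto simp: Z_def)
          then have "z j > 0" using z0[OF that(1)] by simp
          then show ?thesis using that by (intro divide_pos_pos) auto
        qed
        ultimately show "0 < q" by auto
      qed
      define w where "w = (\<lambda>j. if j \<in> cols L then z j + \<epsilon> * d j else 0)"
      have lin: "(\<Sum>j\<in>cols L. g j * w j) = (\<Sum>j\<in>cols L. g j * z j) + \<epsilon> * (\<Sum>j\<in>cols L. g j * d j)" for g
        unfolding sum_distrib_left sum.distrib[symmetric]
        by (intro sum.cong) (auto simp: w_def algebra_simps)
      have "w j \<ge> 0" if j: "j \<in> cols L" for j
      proof (cases "d j < 0")
        case True
        then have "\<epsilon> \<le> z j / - d j" unfolding \<epsilon>_def using j by (intro Min_le[OF fin]) auto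
        then have "\<epsilon> * - d j \<le> z j" by (rule pos_le_divide_eq[THEN iffD1, rotated]) (use True in simp)
        then show ?thesis using j by (simp add: w_def)
      next
        case False then show ?thesis using j \<open>\<epsilon> > 0\<close> z0 by (simp add: w_def)
      qed
      moreover have "w \<in> solutions L"
        using z dA by (auto simp: solutions_def feasible_set_def lin) (simp add: w_def)
      ultimately have "w \<in> feasible_set L" by (simp add: feasible_set_def)
      from opt[OF this] have "0 \<le> \<epsilon> * (\<Sum>j\<in>cols L. c j * d j)" by (simp add: objective_def lin)
      then show ?thesis using \<open>\<epsilon> > 0\<close> by (simp add: sum_negf zero_le_mult_iff)
    qed
    from Farkas[OF finite_cols finI(1) this] obtain l where l: "\<forall>k\<in>I. 0 \<le> l k"
      "\<forall>j\<in>cols L. - c j = (\<Sum>k\<in>I. l k * a k j)" by blast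
    define S where "S = (\<lambda>j. if j \<in> Z then l (Inl j) else 0)"
    have "c j = S j + (\<Sum>i\<in>rows L. (l (Inr (i, False)) - l (Inr (i, True))) * mat_A L i j)" if "j \<in> cols L" for j
    proof -
      have "(\<Sum>k\<in>I. l k * a k j) = (\<Sum>k\<in>Z. l (Inl k) * a (Inl k) j)
          + (\<Sum>k\<in>rows L \<times> (UNIV::bool set). l (Inr k) * a (Inr k) j)"
        unfolding I_def using finI finite_rows by (subst sum.union_disjoint) (auto simp: sum.reindex)
      also have "(\<Sum>k\<in>Z. l (Inl k) * a (Inl k) j) = (\<Sum>k\<in>Z. if k = j then - l (Inl j) else 0)"
        by (intro sum.cong) (auto simp: a_def)
      also have "\<dots> = - S j" using finI by (simp add: S_def)
      also have "(\<Sum>k\<in>rows L \<times> (UNIV::bool set). l (Inr k) * a (Inr k) j)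
          = (\<Sum>i\<in>rows L. \<Sum>b\<in>UNIV. l (Inr (i, b)) * a (Inr (i, b)) j)"
        by (simp add: sum.cartesian_product)
      also have "\<dots> = - (\<Sum>i\<in>rows L. (l (Inr (i, False)) - l (Inr (i, True))) * mat_A L i j)"
        unfolding sum_negf[symmetric] by (intro sum.cong) (auto simp: a_def UNIV_bool algebra_simps)
      finally show ?thesis using bspec[OF l(2) that] by linarith
    qed
    then have "\<exists>\<pi>. \<forall>j\<in>cols L. c j = S j + (\<Sum>i\<in>rows L. \<pi> i * mat_A L i j)"
      by (intro exI[of _ "\<lambda>i. l (Inr (i, False)) - l (Inr (i, True))"]) blast
    moreover have "S j \<ge> 0" for j using l(1) by (auto simp: S_def I_def)
    moreover have "z j \<noteq> 0 \<longrightarrow> S j = 0" for j by (simp add: S_def Z_def)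
    ultimately have "D S" unfolding D_def by blast
    then show ?thesis by blast
  qed
  then obtain S0 where "D S0" by blast
  moreover have "\<forall>S. D S \<longrightarrow> card {j \<in> cols L. S j = 0} < Suc (card (cols L))"
    using finite_cols by (auto simp: less_Suc_eq_le intro: card_mono)
  ultimately have "\<exists>S. D S \<and> (\<forall>S'. D S' \<longrightarrow> card {j \<in> cols L. S' j = 0} \<le> card {j \<in> cols L. S j = 0})"
    by (rule Lattices_Big.ex_has_greatest_nat)
  then obtain S where S: "D S"
    and maxi: "\<And>S'. D S' \<Longrightarrow> card {j \<in> cols L. S' j = 0} \<le> card {j \<in> cols L. S j = 0}" by blast
  define Z where "Z = {j \<in> cols L. S j = 0}"
  have finZ: "finite Z" using finite_cols by (simp add: Z_def)
  obtain \<pi> where S0: "\<And>j. j \<in> cols L \<Longrightarrow> S j \<ge> 0" "\<And>j. j \<in> cols L \<Longrightarrow> z j \<noteq> 0 \<Longrightarrow> S j = 0"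
    and pi: "\<And>j. j \<in> cols L \<Longrightarrow> c j = S j + (\<Sum>i\<in>rows L. \<pi> i * mat_A L i j)"
    using S by (auto simp: D_def)
  have "card (rows L) \<le> card Z"
  proof (rule ccontr)
    assume "\<not> card (rows L) \<le> card Z"
    \<comment> \<open>Fewer zeros than rows means more multipliers than equations. Full row rank
      then makes the combination \<open>g u\<close> nonzero in some column.\<close>
    then obtain u where u: "\<exists>i\<in>rows L. u i \<noteq> 0" "\<forall>j\<in>Z. (\<Sum>i\<in>rows L. mat_A L i j * u i) = 0"
      using homogeneous_system_nontrivial_solution[OF finZ finite_rows, of "\<lambda>j i. mat_A L i j"] by auto
    define g where "g = (\<lambda>u j. \<Sum>i\<in>rows L. u i * mat_A L i j)"
    obtain j0 where j0: "j0 \<in> cols L" "g u j0 \<noteq> 0"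
      using full_rank u(1) by (auto simp: full_row_rank_def g_def)
    have gm: "g (\<lambda>i. - u i) j = - g u j" for j by (simp add: g_def sum_negf)
    have gZ: "\<forall>j\<in>Z. g u j = 0" using u(2) by (simp add: g_def mult.commute)
    \<comment> \<open>The sign is chosen so that some entry is negative; the ratio test defining
      \<open>\<epsilon>\<close> then runs over a nonempty set.\<close>
    obtain w where w: "\<exists>j\<in>cols L. g w j < 0" "\<forall>j\<in>Z. g w j = 0"
    proof (cases "g u j0 < 0")
      case True
      then show ?thesis using j0 gZ by (intro that[of u]) auto
    next
      case False
      then have "g (\<lambda>i. - u i) j0 < 0" using j0 gm by simp
      then show ?thesis using j0 gZ gm by (intro that[of "\<lambda>i. - u i"]) auto
    qed
    define N where "N = {j \<in> cols L. g w j < 0}"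
    define \<epsilon> where "\<epsilon> = Min ((\<lambda>j. S j / - g w j) ` N)"
    have fin: "finite ((\<lambda>j. S j / - g w j) ` N)" "(\<lambda>j. S j / - g w j) ` N \<noteq> {}"
      using finite_cols w(1) by (auto simp: N_def)
    obtain k where k: "k \<in> N" "\<epsilon> = S k / - g w k" using Min_in[OF fin] by (auto simp: \<epsilon>_def)
    have "\<epsilon> \<ge> 0" using k S0(1)[of k] by (auto simp: N_def divide_nonneg_neg)
    define S' where "S' = (\<lambda>j. S j + \<epsilon> * g w j)"
    have zeros: "S' j = 0" if "j \<in> Z" for j using that w(2) by (simp add: S'_def Z_def)
    have "S' j \<ge> 0" if j: "j \<in> cols L" for j
    proof (cases "j \<in> N")
      case True
      then have "\<epsilon> \<le> S j / - g w j" unfolding \<epsilon>_def by (intro Min_le[OF fin(1)]) auto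
      then have "\<epsilon> * - g w j \<le> S j" by (rule pos_le_divide_eq[THEN iffD1, rotated]) (use True in \<open>simp add: N_def\<close>)
      then show ?thesis by (simp add: S'_def)
    next
      case False then show ?thesis using j \<open>\<epsilon> \<ge> 0\<close> S0(1)[OF j] by (simp add: S'_def N_def)
    qed
    moreover have eq: "c j = S' j + (\<Sum>i\<in>rows L. (\<pi> i - \<epsilon> * w i) * mat_A L i j)" if "j \<in> cols L" for j
      using pi[OF that] by (simp add: S'_def g_def left_diff_distrib sum_subtractf sum_distrib_left mult.assoc)
    moreover have "S' j = 0" if "j \<in> cols L" "z j \<noteq> 0" for j
      using zeros[of j] S0(2)[OF that] that by (simp add: Z_def)
    moreover have "\<exists>\<pi>. \<forall>j\<in>cols L. c j = S' j + (\<Sum>i\<in>rows L. \<pi> i * mat_A L i j)"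
      by (intro exI[of _ "\<lambda>i. \<pi> i - \<epsilon> * w i"]) (use eq in blast)
    ultimately have "D S'" unfolding D_def by blast
    have "S' k = 0" using k by (simp add: S'_def N_def)
    moreover have "k \<notin> Z" "k \<in> cols L" using k w(2) by (auto simp: N_def)
    ultimately have "insert k Z \<subseteq> {j \<in> cols L. S' j = 0}" using zeros by (auto simp: Z_def)
    then have "card (insert k Z) \<le> card {j \<in> cols L. S' j = 0}" using finite_cols by (intro card_mono) auto
    then show False using maxi[OF \<open>D S'\<close>] \<open>k \<notin> Z\<close> finZ by (simp add: Z_def)
  qed
  have Sx: "(\<Sum>j\<in>cols L. S j * x j) = objective L c x - (\<Sum>i\<in>rows L. \<pi> i * vec_b L i)" if x: "x \<in> solutions L" for x
  proof -
    have "objective L c x = (\<Sum>j\<in>cols L. S j * x j + (\<Sum>i\<in>rows L. \<pi> i * mat_A L i j) * x j)"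
      unfolding objective_def by (intro sum.cong) (auto simp: pi distrib_right)
    also have "\<dots> = (\<Sum>j\<in>cols L. S j * x j) + (\<Sum>j\<in>cols L. \<Sum>i\<in>rows L. \<pi> i * (mat_A L i j * x j))"
      by (simp add: sum.distrib sum_distrib_right mult.assoc)
    also have "(\<Sum>j\<in>cols L. \<Sum>i\<in>rows L. \<pi> i * (mat_A L i j * x j)) = (\<Sum>i\<in>rows L. \<pi> i * vec_b L i)"
      using x by (subst sum.swap) (simp add: solutions_def flip: sum_distrib_left)
    finally show ?thesis by simp
  qed
  show ?thesis
  proof (rule that[of S])
    fix x assume x: "x \<in> solutions L"
    have "(\<Sum>j\<in>cols L. S j * z j) = 0" using S0 by (intro sum.neutral) auto
    then show "objective L c x - objective L c z = (\<Sum>j\<in>cols L. S j * x j)"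
      using Sx[OF x] Sx[of z] z by (simp add: feasible_set_def)
  next
    have "{j \<in> cols L. S j > 0} = cols L - Z" using S0(1) by (force simp: Z_def)
    then have "card {j \<in> cols L. S j > 0} = card (cols L) - card Z"
      using finZ by (simp add: card_Diff_subset Z_def)
    moreover have "card Z \<le> card (cols L)" using finite_cols by (auto simp: Z_def intro: card_mono)
    ultimately show "card {j \<in> cols L. S j > 0} + card (rows L) \<le> card (cols L)"
      using \<open>card (rows L) \<le> card Z\<close> by simp
  qed (use S0 in auto)
qed

end

text \<open>This covers \<open>T = \<infinity>\<close>: every finite set of visited points occurs in
  an initial segment, so a uniform bound there also yields finiteness.\<close>

lemma finite_increasing_image_bound:
  assumes "\<And>n. enat n \<le> T \<Longrightarrow> card (f ` {..n}) \<le> b"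
  shows "finite (f ` {t. enat t \<le> T}) \<and> card (f ` {t. enat t \<le> T}) \<le> b"
proof (rule finite_if_finite_subsets_card_bdd)
  fix G assume G: "G \<subseteq> f ` {t. enat t \<le> T}" "finite G"
  then obtain D where D: "D \<subseteq> {t. enat t \<le> T}" "finite D" "G = f ` D"
    using finite_subset_image by metis
  show "card G \<le> b"
  proof (cases "D = {}")
    case False
    define n where "n = Max D"
    have "enat n \<le> T" using D(1) Max_in[OF D(2) False] unfolding n_def by blast
    moreover have "G \<subseteq> f ` {..n}" using D Max_ge[of D] by (auto simp: n_def)
    ultimately show ?thesis using assms[of n] card_mono[of "f ` {..n}" G] by simp
  qed (use D in simp)
qed

section \<open>The bound in terms of \<open>s\<close>, \<open>\<delta>\<close>, \<open>h\<close> and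
  \<open>d\<close>\<close>

context standard_lp
begin

theorem steepest_edge_run_bound:
  assumes run: "steepest_edge_run L c Bs T"
    and s: "\<And>x. x \<in> feasible_set L \<Longrightarrow> (\<Sum>j\<in>cols L. x j) \<le> s"
    and \<delta>: "\<And>B j. feasible_basis L B \<Longrightarrow> basic_solution L B j > 0 \<Longrightarrow> \<delta> \<le> basic_solution L B j"
    and h: "\<And>B q. feasible_basis L B \<Longrightarrow> q \<in> cols L - B \<Longrightarrow> L2_set (edge_direction L B q) (cols L) \<le> h"
    and d: "\<And>B B'. feasible_basis L B \<Longrightarrow> feasible_basis L B' \<Longrightarrow> basic_solution L B' \<noteq> basic_solution L B
        \<Longrightarrow> d \<le> L2_set (\<lambda>j. basic_solution L B' j - basic_solution L B j) (cols L)"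
    and pos: "0 < s" "0 < \<delta>" "0 < h" "0 < d"
    and K: "K \<ge> 1" "real K \<ge> h * s / d * ln (s / \<delta>)"
  shows "finite (visited_vertices L Bs T) \<and>
    card (visited_vertices L Bs T) \<le> (card (cols L) - card (rows L)) * K + 1"
proof -
  define x where "x = (\<lambda>t. basic_solution L (Bs t))"
  have fb: "feasible_basis L (Bs t)" if "enat t \<le> T" for t
    using that
  proof (induction t)
    case 0 then show ?case using run by (simp add: steepest_edge_run_def)
  next
    case (Suc t)
    then have lt: "enat t < T" using Suc_ile_eq by blast
    then obtain q p where "steepest_edge_entering L c (Bs t) q" "ratio_test_leaving L (Bs t) q p"
      "Bs (Suc t) = insert q (Bs t - {p})"
      using run by (auto simp: steepest_edge_run_def steepest_edge_pivot_def)
    then show ?case using pivot_step(1) Suc.IH lt by (auto simp: steepest_edge_entering_def)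
  qed
  have xf: "x t \<in> feasible_set L" if "enat t \<le> T" for t
    using fb[OF that] by (simp add: x_def feasible_basis_def)
  have "feasible_set L \<noteq> {}" using xf[of 0] zero_enat_def by auto
  from objective_attains_minimum[OF this s] obtain z where z: "z \<in> feasible_set L"
    and opt: "\<And>x. x \<in> feasible_set L \<Longrightarrow> objective L c z \<le> objective L c x" by blast
  from optimal_dual[OF z opt] obtain S where S: "\<And>j. j \<in> cols L \<Longrightarrow> S j \<ge> 0"
    and gap: "\<And>x. x \<in> solutions L \<Longrightarrow> objective L c x - objective L c z = (\<Sum>j\<in>cols L. S j * x j)"
    and cardS: "card {j \<in> cols L. S j > 0} + card (rows L) \<le> card (cols L)" by blast
  define J where "J = {j \<in> cols L. S j > 0}"
  have J: "finite J" "J \<subseteq> cols L" using finite_cols by (auto simp: J_def)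
  have v: "(\<Sum>j\<in>J. S j * x t j) = objective L c (x t) - objective L c z" if "enat t \<le> T" for t
  proof -
    have "(\<Sum>j\<in>J. S j * x t j) = (\<Sum>j\<in>cols L. S j * x t j)"
      using finite_cols S by (intro sum.mono_neutral_left) (force simp: J_def)+
    then show ?thesis using gap xf[OF that] by (simp add: feasible_set_def)
  qed
  \<comment> \<open>The exponential replaces the contraction factor \<open>1 - d / (h * s)\<close>.
    It is always positive, its powers reach \<open>\<delta> / s\<close> precisely at the required
    \<open>K\<close>, and being strictly larger it supplies the strict decrease that
    \<open>distinct_values_bound\<close> asks for.\<close>
  define r where "r = exp (- (d / (h * s)))"
  have r: "0 < r" "r \<le> 1" using pos by (auto simp: r_def)
  have rK: "r ^ K * s \<le> \<delta>"
  proof -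
    have "r ^ K = exp (- (real K * (d / (h * s))))" by (simp add: r_def flip: exp_of_nat_mult)
    also have "\<dots> \<le> exp (- ln (s / \<delta>))"
    proof -
      have "ln (s / \<delta>) = h * s / d * ln (s / \<delta>) * (d / (h * s))" using pos by simp
      also have "\<dots> \<le> real K * (d / (h * s))" using pos by (intro mult_right_mono K(2)) auto
      finally show ?thesis by simp
    qed
    also have "\<dots> = \<delta> / s" using pos by (simp add: exp_minus)
    finally show ?thesis using pos by (simp add: field_simps)
  qed
  have "card (x ` {..n}) \<le> (card (cols L) - card (rows L)) * K + 1" if n: "enat n \<le> T" for n
  proof -
    have le: "enat t \<le> T" if "t \<le> n" for t using n that by (meson enat_ord_simps(1) order_trans)
    have "card (x ` {..n}) \<le> card J * K + 1"
    proof (rule distinct_values_bound[where S = S and r = r and s = s and \<delta> = \<delta>])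
      fix t j assume t: "t \<le> n" and j: "j \<in> J"
      show "0 \<le> x t j" using xf[OF le[OF t]] j J by (auto simp: feasible_set_def)
      show "\<delta> \<le> x t j" if "0 < x t j" using \<delta>[OF fb[OF le[OF t]]] that by (simp add: x_def)
    next
      fix t assume t: "t \<le> n"
      have "(\<Sum>j\<in>J. x t j) \<le> (\<Sum>j\<in>cols L. x t j)"
        using finite_cols J xf[OF le[OF t]] by (intro sum_mono2) (auto simp: feasible_set_def)
      then show "(\<Sum>j\<in>J. x t j) \<le> s" using s[OF xf[OF le[OF t]]] by simp
    next
      fix t assume t: "t < n" and ne: "x (Suc t) \<noteq> x t"
      have T: "enat t \<le> T" "enat (Suc t) \<le> T" "enat t < T"
        using le[of t] le[of "Suc t"] t Suc_ile_eq by auto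
      have piv: "steepest_edge_pivot L c (Bs t) (Bs (Suc t))" using run T by (simp add: steepest_edge_run_def)
      note pr = steepest_edge_pivot_progress[OF fb[OF T(1)] piv h[OF fb[OF T(1)]] z s[OF z]
        less_imp_le[OF pos(4)] d[OF fb[OF T(1)] fb[OF T(2)] ne[unfolded x_def]]]
      define v where "v = objective L c (x t) - objective L c z"
      define v' where "v' = objective L c (x (Suc t)) - objective L c z"
      have 1: "d * v \<le> h * s * (v - v')" using pr(1) by (simp add: v_def v'_def x_def)
      have 2: "v' < v" using pr(2) ne by (simp add: v_def v'_def x_def)
      have "0 \<le> v'" using opt[OF xf[OF T(2)]] by (simp add: v'_def)
      have "v' \<le> (1 - d / (h * s)) * v" using 1 pos by (simp add: field_simps)
      also have "\<dots> < r * v"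
      proof -
        have "1 - d / (h * s) < r"
          using exp_minus_greater[of "d / (h * s)"] pos by (simp add: r_def)
        then show ?thesis using 2 \<open>0 \<le> v'\<close> by simp
      qed
      finally show "(\<Sum>j\<in>J. S j * x (Suc t) j) < r * (\<Sum>j\<in>J. S j * x t j)"
        unfolding v[OF T(1)] v[OF T(2)] v_def v'_def .
    qed (use J r rK K in \<open>auto simp: J_def\<close>)
    moreover have "card J \<le> card (cols L) - card (rows L)"
      using cardS unfolding J_def by linarith
    ultimately show ?thesis by (meson add_le_mono1 mult_le_mono1 order_trans)
  qed
  from finite_increasing_image_bound[of T x, OF this]
  show ?thesis by (simp add: visited_vertices_def x_def image_Collect)
qed

end

section \<open>Incidence and network matrices\<close>

text \<open>Each level set of \<open>\<bar>y\<bar>\<close> other than that of \<open>0\<close> is closed under the edges different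
  from \<open>j\<close>, so by uniqueness it has to meet the edge \<open>j\<close>.\<close>

lemma incidence_dual_half_integral:
  fixes y :: "'v \<Rightarrow> real" and F :: "'c \<Rightarrow> 'v set"
  assumes F: "\<And>c. c \<in> B \<Longrightarrow> \<exists>u v. F c = {u, v}"
    and j: "j \<in> B" and eq: "\<And>c. c \<in> B \<Longrightarrow> sum y (F c) = of_bool (c = j)"
    and uniq: "\<And>w :: _ \<Rightarrow> real. (\<And>v. y v = 0 \<Longrightarrow> w v = 0) \<Longrightarrow> (\<And>c. c \<in> B \<Longrightarrow> sum w (F c) = 0) \<Longrightarrow> \<forall>v. w v = 0"
  shows "\<bar>y v\<bar> \<in> {0, 1/2, 1}"
proof (cases "y v = 0")
  case False
  define g where "g = (\<lambda>u. if \<bar>y u\<bar> = \<bar>y v\<bar> then y u else 0)"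
  define \<tau> where "\<tau> = sum g (F j)"
  \<comment> \<open>The ends of such an edge have opposite values, so the level set contains both,
    and they cancel, or neither. If \<open>F c\<close> is a singleton, \<open>y\<close> is zero
    there, which is outside the level set.\<close>
  have gc: "sum g (F c) = 0" if "c \<in> B" "c \<noteq> j" for c
  proof -
    obtain p q where pq: "F c = {p, q}" using F \<open>c \<in> B\<close> by blast
    show ?thesis using eq[OF \<open>c \<in> B\<close>] that False by (cases "p = q") (auto simp: pq g_def)
  qed
  \<comment> \<open>Subtracting \<open>\<tau> * y\<close> also annihilates edge \<open>j\<close>, so
    \<open>g\<close> is a multiple of \<open>y\<close>; comparison at \<open>v\<close> gives
    \<open>\<tau> = 1\<close>.\<close>
  have "\<forall>u. g u - \<tau> * y u = 0"
  proof (rule uniq)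
    fix c assume c: "c \<in> B"
    have "(\<Sum>u\<in>F c. g u - \<tau> * y u) = sum g (F c) - \<tau> * sum y (F c)"
      by (simp add: sum_subtractf sum_distrib_left)
    then show "(\<Sum>u\<in>F c. g u - \<tau> * y u) = 0" using gc c eq by (cases "c = j") (auto simp: \<tau>_def)
  qed (simp add: g_def)
  then have "g v = \<tau> * y v" by (simp add: algebra_simps)
  then have \<tau>: "\<tau> = 1" using False by (simp add: g_def)
  \<comment> \<open>A sum of 1 over the level set at \<open>j\<close> means one node of value 1 or
    two ends of value 1/2 each.\<close>
  obtain p q where pq: "F j = {p, q}" using F j by blast
  show ?thesis using eq[OF j] \<tau> False
    by (cases "p = q") (auto simp: \<tau>_def pq g_def abs_if split: if_splits)
qed simp

text \<open>Arcs other than \<open>j\<close> join equal potentials, so a nonzero level set must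
  separate the ends of \<open>j\<close>: it has value 1 and contains only the tail, or value -1 and
  contains only the head. The value at the tail decides which case occurs for all nodes alike. This
  common sign makes potential differences at most 1 in absolute value, rather than 2.\<close>

lemma network_dual_unit:
  fixes z :: "'n \<Rightarrow> real" and t h :: "'c \<Rightarrow> 'n"
  assumes j: "j \<in> B" and eq: "\<And>c. c \<in> B \<Longrightarrow> z (t c) - z (h c) = of_bool (c = j)"
    and uniq: "\<And>w :: _ \<Rightarrow> real. (\<And>p. z p = 0 \<Longrightarrow> w p = 0) \<Longrightarrow> (\<And>c. c \<in> B \<Longrightarrow> w (t c) - w (h c) = 0) \<Longrightarrow> \<forall>p. w p = 0"
  shows "(\<forall>p. z p \<in> {0, 1}) \<or> (\<forall>p. z p \<in> {0, -1})"
proof -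
  have level: "(z p = 1 \<and> z (t j) = 1 \<and> z (h j) = 0) \<or> (z p = -1 \<and> z (t j) = 0 \<and> z (h j) = -1)" if p: "z p \<noteq> 0" for p
  proof -
    define g where "g = (\<lambda>u. if z u = z p then z u else 0)"
    define \<tau> where "\<tau> = g (t j) - g (h j)"
    have gc: "g (t c) - g (h c) = 0" if "c \<in> B" "c \<noteq> j" for c
      using eq[of c] that by (simp add: g_def)
    have "\<forall>u. g u - \<tau> * z u = 0"
    proof (rule uniq)
      fix c assume c: "c \<in> B"
      have "(g (t c) - \<tau> * z (t c)) - (g (h c) - \<tau> * z (h c)) = (g (t c) - g (h c)) - \<tau> * (z (t c) - z (h c))"
        by (simp add: algebra_simps)
      then show "(g (t c) - \<tau> * z (t c)) - (g (h c) - \<tau> * z (h c)) = 0"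
        using gc c eq[OF c] by (cases "c = j") (auto simp: \<tau>_def)
    qed (simp add: g_def)
    then have "g p = \<tau> * z p" by (simp add: algebra_simps)
    then have "\<tau> = 1" using p by (simp add: g_def)
    then show ?thesis using eq[OF j] p by (auto simp: \<tau>_def g_def split: if_splits)
  qed
  show ?thesis
  proof (cases "z (t j) = 1")
    case True
    then have "z p = 0 \<or> z p = 1" for p using level[of p] by fastforce
    then show ?thesis by auto
  next
    case False
    then have "z p = 0 \<or> z p = -1" for p using level[of p] by fastforce
    then show ?thesis by auto
  qed
qed

lemma L2_set_ge_of_member:
  assumes "finite A" "a \<in> A" "r \<le> \<bar>f a\<bar>"
  shows "r \<le> L2_set f A"
  using member_le_L2_set[OF assms(1,2), of "\<lambda>x. \<bar>f x\<bar>"] assms(3) by (simp add: L2_set_def)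

text \<open>The support of a difference of two vertices contains four entries \<open>a\<close>,
  \<open>b\<close>, \<open>e\<close>, \<open>f\<close> in a zigzag: \<open>a\<close> and
  \<open>b\<close> share a tail, \<open>a\<close> and \<open>e\<close> a head, \<open>e\<close> and
  \<open>f\<close> a tail. Each is a nonzero integer, so the norm is at least 2. The head
  \<open>j0\<close> stands for a node without an equation.\<close>

lemma transport_difference_norm:
  fixes D :: "'c \<Rightarrow> real" and t h :: "'c \<Rightarrow> 'n"
  assumes fin: "finite C" and int: "\<And>c. c \<in> C \<Longrightarrow> D c \<in> \<int>"
    and inj: "inj_on (\<lambda>c. (t c, h c)) C"
    and tails: "\<And>c. c \<in> C \<Longrightarrow> (\<Sum>b\<in>{b\<in>C. t b = t c}. D b) = 0"
    and heads: "\<And>c. c \<in> C \<Longrightarrow> h c \<noteq> j0 \<Longrightarrow> (\<Sum>b\<in>{b\<in>C. h b = h c}. D b) = 0"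
    and ne: "c0 \<in> C" "D c0 \<noteq> 0"
  shows "2 \<le> L2_set D C"
proof -
  have other: "\<exists>b\<in>C. P b \<and> b \<noteq> c \<and> D b \<noteq> 0"
    if s: "(\<Sum>b\<in>{b\<in>C. P b}. D b) = 0" and c: "c \<in> C" "P c" "D c \<noteq> 0" for P c
  proof (rule ccontr)
    assume "\<not> ?thesis"
    then have "(\<Sum>b\<in>{b\<in>C. P b}. D b) = (\<Sum>b\<in>{c}. D b)"
      using fin c by (intro sum.mono_neutral_right) auto
    then show False using s c by simp
  qed
  have tail: "\<exists>b\<in>C. t b = t c \<and> b \<noteq> c \<and> D b \<noteq> 0" if "c \<in> C" "D c \<noteq> 0" for c
    using other[OF tails[OF that(1)] that(1) _ that(2)] by blast
  have head: "\<exists>b\<in>C. h b = h c \<and> b \<noteq> c \<and> D b \<noteq> 0" if "c \<in> C" "D c \<noteq> 0" "h c \<noteq> j0" for c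
    using other[OF heads[OF that(1,3)] that(1) _ that(2)] by blast
  have sep: "t b \<noteq> t c \<or> h b \<noteq> h c" if "b \<in> C" "c \<in> C" "b \<noteq> c" for b c
    using inj that by (auto simp: inj_on_def)
  obtain c1 where c1: "c1 \<in> C" "t c1 = t c0" "c1 \<noteq> c0" "D c1 \<noteq> 0" using tail ne by blast
  \<comment> \<open>Two entries with the same tail have different heads, so at least one of them
    avoids \<open>j0\<close>.\<close>
  obtain a b where ab: "a \<in> C" "b \<in> C" "t a = t b" "a \<noteq> b" "D a \<noteq> 0" "D b \<noteq> 0" "h a \<noteq> j0"
  proof (cases "h c0 = j0")
    case True
    then have "h c1 \<noteq> j0" using sep[of c0 c1] c1 ne by auto
    then show ?thesis using that[of c1 c0] c1 ne by auto
  next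
    case False
    then show ?thesis using that[of c0 c1] c1 ne by auto
  qed
  obtain e where e: "e \<in> C" "h e = h a" "e \<noteq> a" "D e \<noteq> 0" using head ab by blast
  have te: "t e \<noteq> t a" using sep[of e a] e ab by auto
  obtain f where f: "f \<in> C" "t f = t e" "f \<noteq> e" "D f \<noteq> 0" using tail e by blast
  have "e \<noteq> b" "f \<noteq> a" "f \<noteq> b" using te ab f by auto
  then have card: "card {a, b, e, f} = 4" using ab e f by auto
  have "1 \<le> (D c)\<^sup>2" if "c \<in> {a, b, e, f}" for c
  proof -
    have "c \<in> C" "D c \<noteq> 0" using that ab e f by auto
    then have "1 \<le> \<bar>D c\<bar>" using int Ints_nonzero_abs_ge1 by blast
    then show ?thesis using one_le_power[of "\<bar>D c\<bar>" 2] by simp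
  qed
  then have "(\<Sum>c\<in>{a, b, e, f}. 1) \<le> (\<Sum>c\<in>{a, b, e, f}. (D c)\<^sup>2)" by (rule sum_mono)
  also have "\<dots> \<le> (\<Sum>c\<in>C. (D c)\<^sup>2)" using fin ab e f by (intro sum_mono2) auto
  finally have "4 \<le> (\<Sum>c\<in>C. (D c)\<^sup>2)" using card by simp
  then show ?thesis using real_le_rsqrt[of 2 "\<Sum>c\<in>C. (D c)\<^sup>2"] by (simp add: L2_set_def)
qed

lemma (in standard_lp) edge_direction_norm_le:
  assumes B: "is_basis L B" and q: "q \<in> cols L - B"
    and a: "\<And>k. k \<in> B \<Longrightarrow> \<bar>edge_direction L B q k\<bar> \<le> a"
  shows "L2_set (edge_direction L B q) (cols L) \<le> sqrt (a\<^sup>2 * real (card (rows L)) + 1)"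
proof -
  have "(\<Sum>k\<in>cols L. (edge_direction L B q k)\<^sup>2) = (\<Sum>k\<in>insert q B. (edge_direction L B q k)\<^sup>2)"
    using q basisD(1)[OF B] finite_cols by (intro sum.mono_neutral_right) (auto simp: edge_direction_def)
  also have "\<dots> = 1 + (\<Sum>k\<in>B. (edge_direction L B q k)\<^sup>2)"
    using q basisD(2)[OF B] by (simp add: edge_direction_def)
  also have "(\<Sum>k\<in>B. (edge_direction L B q k)\<^sup>2) \<le> (\<Sum>k\<in>B. a\<^sup>2)"
    using a by (intro sum_mono) (metis abs_ge_zero power2_abs power_mono)
  also have "\<dots> = a\<^sup>2 * real (card (rows L))" using basisD(3)[OF B] by simp
  finally show ?thesis by (simp add: L2_set_def add.commute)
qed

section \<open>Run bounds for incidence and network structure\<close>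

context standard_lp
begin

text \<open>Doubled entries of \<open>y\<close> are integers, hence vertices are half-integral:
  positive coordinates are at least 1/2, and different vertices differ by at least 1/2 in some
  coordinate. An edge direction pairs \<open>y\<close> with at most two nodes, so its basic entries
  are at most 2 in absolute value and \<open>h = sqrt (4 * r + 1)\<close> for \<open>r\<close>
  rows.\<close>

theorem incidence_run_bound:
  fixes F :: "'c \<Rightarrow> 'r set"
  assumes F: "\<And>c. c \<in> cols L \<Longrightarrow> \<exists>u v. F c = {u, v}"
    and A: "\<And>i c. i \<in> rows L \<Longrightarrow> c \<in> cols L \<Longrightarrow> mat_A L i c = of_bool (i \<in> F c)"
    and b: "\<And>i. i \<in> rows L \<Longrightarrow> vec_b L i = 1"
    and run: "steepest_edge_run L c Bs T"
    and s: "\<And>x. x \<in> feasible_set L \<Longrightarrow> (\<Sum>j\<in>cols L. x j) \<le> s" "0 < s"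
    and K: "K \<ge> 1" "real K \<ge> 2 * s * sqrt (4 * real (card (rows L)) + 1) * ln (2 * s)"
  shows "finite (visited_vertices L Bs T) \<and>
    card (visited_vertices L Bs T) \<le> (card (cols L) - card (rows L)) * K + 1"
proof -
  have sumF: "(\<Sum>i\<in>rows L. w i * mat_A L i c) = sum w (F c)"
    if "c \<in> cols L" "\<And>i. i \<notin> rows L \<Longrightarrow> w i = 0" for w c
  proof -
    have "finite (F c)" using F[OF that(1)] by auto
    have "(\<Sum>i\<in>rows L. w i * mat_A L i c) = (\<Sum>i\<in>rows L \<inter> F c. w i)"
      using A that(1) finite_rows by (intro sum.mono_neutral_cong_right) auto
    also have "\<dots> = sum w (F c)" using that(2) \<open>finite (F c)\<close> by (intro sum.mono_neutral_left) auto
    finally show ?thesis .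
  qed
  have bas: "2 * basic_solution L B k \<in> \<int> \<and> (\<forall>q\<in>cols L. \<bar>edge_direction L B q k\<bar> \<le> 2)"
    if B: "is_basis L B" and k: "k \<in> B" for B k
  proof -
    obtain y where y: "\<And>i. i \<notin> rows L \<Longrightarrow> y i = 0"
      "\<And>j. j \<in> B \<Longrightarrow> (\<Sum>i\<in>rows L. y i * mat_A L i j) = of_bool (j = k)"
      "\<And>x. x \<in> solutions L \<Longrightarrow> (\<And>j. j \<notin> B \<Longrightarrow> x j = 0) \<Longrightarrow> x k = (\<Sum>i\<in>rows L. y i * vec_b L i)"
      "\<And>q. edge_direction L B q k = - (\<Sum>i\<in>rows L. y i * mat_A L i q)"
      using dual_basis_vector[OF B k] by blast
    note sub = subsetD[OF basisD(1)[OF B]]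
    have half: "\<bar>y v\<bar> \<in> {0, 1/2, 1}" for v
    proof (rule incidence_dual_half_integral[where F = F, OF _ k])
      show "\<exists>u v. F c = {u, v}" if "c \<in> B" for c using F sub that by blast
      show "sum y (F c) = of_bool (c = k)" if "c \<in> B" for c
        using sumF[of c y, OF sub[OF that] y(1)] y(2)[OF that] by simp
      fix w :: "'r \<Rightarrow> real"
      assume w: "\<And>v. y v = 0 \<Longrightarrow> w v = 0" "\<And>c. c \<in> B \<Longrightarrow> sum w (F c) = 0"
      have w0: "w i = 0" if "i \<notin> rows L" for i using w(1) y(1) that by blast
      have "\<forall>c\<in>B. (\<Sum>i\<in>rows L. w i * mat_A L i c) = 0"
        using sumF[of _ w, OF sub w0] w(2) by simp
      from basis_dual_kernel[OF B this] show "\<forall>v. w v = 0" using w0 by blast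
    qed
    have yint: "2 * y i \<in> \<int>" for i
    proof -
      have "2 * y i \<in> {0, 1, -1, 2, -2}" using half[of i] by auto
      then show ?thesis by auto
    qed
    have eq: "2 * basic_solution L B k = (\<Sum>i\<in>rows L. 2 * y i)"
      using y(3)[OF basic_solution[OF B]] b by (simp add: sum_distrib_left)
    have "2 * basic_solution L B k \<in> \<int>" unfolding eq by (intro Ints_sum yint)
    moreover have "\<bar>edge_direction L B q k\<bar> \<le> 2" if q: "q \<in> cols L" for q
    proof -
      obtain u v where uv: "F q = {u, v}" using F q by blast
      have "\<bar>y u\<bar> \<le> 1" "\<bar>y v\<bar> \<le> 1" using half[of u] half[of v] by auto
      then have "\<bar>sum y (F q)\<bar> \<le> 2" unfolding uv by (cases "u = v") auto
      then show ?thesis using y(4) sumF[of q y, OF q y(1)] by simp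
    qed
    ultimately show ?thesis by blast
  qed
  have int: "2 * basic_solution L B k \<in> \<int>" if "feasible_basis L B" for B k
    using bas[of B k] basic_solution(2)[of B k] that by (cases "k \<in> B") (auto simp: feasible_basis_def)
  show ?thesis
  proof (rule steepest_edge_run_bound[OF run s(1), where \<delta> = "1/2" and d = "1/2"
        and h = "sqrt (4 * real (card (rows L)) + 1)"])
    fix B k assume B: "feasible_basis L B" and "0 < basic_solution L B k"
    then have "1 \<le> \<bar>2 * basic_solution L B k\<bar>"
      using int[OF B] by (intro Ints_nonzero_abs_ge1) auto
    then show "1/2 \<le> basic_solution L B k" using \<open>0 < basic_solution L B k\<close> by simp
  next
    fix B q assume B: "feasible_basis L B" and q: "q \<in> cols L - B"
    then show "L2_set (edge_direction L B q) (cols L) \<le> sqrt (4 * real (card (rows L)) + 1)"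
      using edge_direction_norm_le[of B q 2] bas[of B] by (auto simp: feasible_basis_def)
  next
    fix B B' assume B: "feasible_basis L B" "feasible_basis L B'"
      and ne: "basic_solution L B' \<noteq> basic_solution L B"
    then obtain k where k: "basic_solution L B' k \<noteq> basic_solution L B k" by auto
    have "k \<in> cols L" using k B by (force simp: feasible_basis_def feasible_set_def solutions_def)
    have "2 * basic_solution L B' k - 2 * basic_solution L B k \<in> \<int>" using int B by (intro Ints_diff)
    then have "1 \<le> \<bar>2 * basic_solution L B' k - 2 * basic_solution L B k\<bar>"
      using k by (intro Ints_nonzero_abs_ge1) auto
    then show "1/2 \<le> L2_set (\<lambda>j. basic_solution L B' j - basic_solution L B j) (cols L)"
      by (intro L2_set_ge_of_member[OF finite_cols \<open>k \<in> cols L\<close>]) linarith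
  qed (use s K in \<open>auto simp: mult_ac add_nonneg_pos\<close>)
qed

text \<open>\<open>pot\<close> and \<open>unpot\<close> hide the matrix: combinations of rows
  correspond to potentials vanishing outside \<open>N\<close>, evaluated as differences along arcs.
  \<open>pot\<close> carries the dual vector to the network and brings integrality back;
  \<open>unpot\<close> carries nonsingularity of the basis over. \<open>P\<close> is the set of tail
  nodes, so all coordinates together sum to \<open>n\<close>; \<open>p0\<close> is the one head
  allowed to lack an equation.\<close>

theorem transport_run_bound:
  fixes t h :: "'c \<Rightarrow> 'n" and N :: "'n set"
  assumes pot: "\<And>y. \<exists>z. (\<forall>p. p \<notin> N \<longrightarrow> z p = 0) \<and>
        (\<forall>c\<in>cols L. (\<Sum>i\<in>rows L. y i * mat_A L i c) = z (t c) - z (h c)) \<and>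
        ((\<forall>p. z p \<in> \<int>) \<longrightarrow> (\<Sum>i\<in>rows L. y i * vec_b L i) \<in> \<int>)"
    and unpot: "\<And>w. (\<And>p. p \<notin> N \<Longrightarrow> w p = 0) \<Longrightarrow>
        \<exists>y. (\<forall>c\<in>cols L. (\<Sum>i\<in>rows L. y i * mat_A L i c) = w (t c) - w (h c)) \<and>
          ((\<forall>i\<in>rows L. y i = 0) \<longrightarrow> (\<forall>p. w p = 0))"
    and inj: "inj_on (\<lambda>c. (t c, h c)) (cols L)"
    and tails: "\<And>x p. x \<in> solutions L \<Longrightarrow> p \<in> P \<Longrightarrow> (\<Sum>c\<in>{c\<in>cols L. t c = p}. x c) = 1"
    and heads: "\<And>x c. x \<in> solutions L \<Longrightarrow> c \<in> cols L \<Longrightarrow> h c \<noteq> p0 \<Longrightarrow>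
        (\<Sum>b\<in>{b\<in>cols L. h b = h c}. x b) = 1"
    and P: "finite P" "t ` cols L \<subseteq> P" "card P = n" "n \<ge> 1"
    and r: "card (rows L) + 1 \<le> 2 * n"
    and run: "steepest_edge_run L c Bs T"
    and K: "K \<ge> 1" "real K \<ge> real n * sqrt (real n / 2) * ln (real n)"
  shows "finite (visited_vertices L Bs T) \<and>
    card (visited_vertices L Bs T) \<le> (card (cols L) - card (rows L)) * K + 1"
proof -
  have bas: "basic_solution L B k \<in> \<int> \<and> (\<forall>q\<in>cols L. \<bar>edge_direction L B q k\<bar> \<le> 1)"
    if B: "is_basis L B" and k: "k \<in> B" for B k
  proof -
    obtain y where "\<And>i. i \<notin> rows L \<Longrightarrow> y i = 0" and y:
      "\<And>j. j \<in> B \<Longrightarrow> (\<Sum>i\<in>rows L. y i * mat_A L i j) = of_bool (j = k)"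
      "\<And>x. x \<in> solutions L \<Longrightarrow> (\<And>j. j \<notin> B \<Longrightarrow> x j = 0) \<Longrightarrow> x k = (\<Sum>i\<in>rows L. y i * vec_b L i)"
      "\<And>q. edge_direction L B q k = - (\<Sum>i\<in>rows L. y i * mat_A L i q)"
      using dual_basis_vector[OF B k] by blast
    from pot[of y] obtain z where z0: "\<forall>p. p \<notin> N \<longrightarrow> z p = 0"
      and z: "\<forall>c\<in>cols L. (\<Sum>i\<in>rows L. y i * mat_A L i c) = z (t c) - z (h c)"
      and zint: "(\<forall>p. z p \<in> \<int>) \<longrightarrow> (\<Sum>i\<in>rows L. y i * vec_b L i) \<in> \<int>" by blast
    note sub = subsetD[OF basisD(1)[OF B]]
    have unit: "(\<forall>p. z p \<in> {0, 1}) \<or> (\<forall>p. z p \<in> {0, -1})"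
    proof (rule network_dual_unit[where t = t and h = h, OF k])
      show "z (t c) - z (h c) = of_bool (c = k)" if "c \<in> B" for c
        using bspec[OF z sub[OF that]] y(1)[OF that] by simp
      fix w :: "'n \<Rightarrow> real"
      assume w: "\<And>p. z p = 0 \<Longrightarrow> w p = 0" "\<And>c. c \<in> B \<Longrightarrow> w (t c) - w (h c) = 0"
      have "\<And>p. p \<notin> N \<Longrightarrow> w p = 0" using w(1) z0 by blast
      from unpot[of w, OF this] obtain u where u: "\<forall>c\<in>cols L. (\<Sum>i\<in>rows L. u i * mat_A L i c) = w (t c) - w (h c)"
        "(\<forall>i\<in>rows L. u i = 0) \<longrightarrow> (\<forall>p. w p = 0)" by blast
      have "\<forall>c\<in>B. (\<Sum>i\<in>rows L. u i * mat_A L i c) = 0" using u(1) sub w(2) by simp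
      from mp[OF u(2) basis_dual_kernel[OF B this]] show "\<forall>p. w p = 0" .
    qed
    have "\<forall>p. z p \<in> \<int>"
    proof
      fix p have "z p \<in> {0, 1, -1}" using unit by auto
      then show "z p \<in> \<int>" by auto
    qed
    then have "basic_solution L B k \<in> \<int>" using zint y(2)[OF basic_solution[OF B]] by simp
    moreover have "\<bar>edge_direction L B q k\<bar> \<le> 1" if "q \<in> cols L" for q
    proof -
      have "\<bar>z a - z b\<bar> \<le> 1" for a b
        using unit
      proof
        assume "\<forall>p. z p \<in> {0, 1}"
        then have "z a \<in> {0, 1}" "z b \<in> {0, 1}" by blast+
        then show ?thesis by auto
      next
        assume "\<forall>p. z p \<in> {0, -1}"
        then have "z a \<in> {0, -1}" "z b \<in> {0, -1}" by blast+
        then show ?thesis by auto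
      qed
      then show ?thesis using y(3)[of q] bspec[OF z that] by simp
    qed
    ultimately show ?thesis by blast
  qed
  have int: "basic_solution L B k \<in> \<int>" if "feasible_basis L B" for B k
    using bas[of B k] basic_solution(2)[of B k] that by (cases "k \<in> B") (auto simp: feasible_basis_def)
  have s: "(\<Sum>c\<in>cols L. x c) \<le> real n" if x: "x \<in> feasible_set L" for x
  proof -
    have "(\<Sum>c\<in>cols L. x c) = (\<Sum>p\<in>P. \<Sum>c\<in>{c\<in>cols L. t c = p}. x c)"
      using sum.group[OF finite_cols P(1,2), of x] by simp
    also have "\<dots> = real n" using tails x P(3) by (simp add: feasible_set_def)
    finally show ?thesis by simp
  qed
  have eq: "sqrt (2 * real n) * real n / 2 = real n * sqrt (real n / 2)"
  proof -
    have "sqrt (2 * real n) = sqrt (4 * (real n / 2))" by simp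
    also have "\<dots> = 2 * sqrt (real n / 2)" by (subst real_sqrt_mult) simp
    finally show ?thesis by simp
  qed
  \<comment> \<open>The required quantity \<open>h * s / d * ln (s / \<delta>)\<close> for
    \<open>h = sqrt (2 * n)\<close>, \<open>s = n\<close>, \<open>d = 2\<close>,
    \<open>\<delta> = 1\<close>.\<close>
  have K': "real K \<ge> sqrt (2 * real n) * real n / 2 * ln (real n / 1)" unfolding eq div_by_1 by (rule K(2))
  show ?thesis
  proof (rule steepest_edge_run_bound[OF run s, where \<delta> = 1 and d = 2 and h = "sqrt (2 * real n)"])
    fix B k assume B: "feasible_basis L B" and "0 < basic_solution L B k"
    then have "1 \<le> \<bar>basic_solution L B k\<bar>"
      using int[OF B] by (intro Ints_nonzero_abs_ge1) auto
    then show "1 \<le> basic_solution L B k" using \<open>0 < basic_solution L B k\<close> by simp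
  next
    fix B q assume B: "feasible_basis L B" and q: "q \<in> cols L - B"
    then have "L2_set (edge_direction L B q) (cols L) \<le> sqrt (1\<^sup>2 * real (card (rows L)) + 1)"
      using bas[of B] by (intro edge_direction_norm_le) (auto simp: feasible_basis_def)
    also have "\<dots> \<le> sqrt (2 * real n)" using r by simp
    finally show "L2_set (edge_direction L B q) (cols L) \<le> sqrt (2 * real n)" .
  next
    fix B B' assume B: "feasible_basis L B" "feasible_basis L B'"
      and ne: "basic_solution L B' \<noteq> basic_solution L B"
    then obtain k where k: "basic_solution L B' k \<noteq> basic_solution L B k" by auto
    have sol: "basic_solution L B \<in> solutions L" "basic_solution L B' \<in> solutions L"
      using B by (auto simp: feasible_basis_def feasible_set_def)
    have kc: "k \<in> cols L" using k sol by (force simp: solutions_def)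
    show "2 \<le> L2_set (\<lambda>j. basic_solution L B' j - basic_solution L B j) (cols L)"
    proof (rule transport_difference_norm[OF finite_cols _ inj _ _ kc])
      show "basic_solution L B' c - basic_solution L B c \<in> \<int>" for c using int B by (intro Ints_diff)
      show "(\<Sum>b\<in>{b\<in>cols L. t b = t c}. basic_solution L B' b - basic_solution L B b) = 0" if "c \<in> cols L" for c
        using tails[OF sol(1), of "t c"] tails[OF sol(2), of "t c"] P that by (simp add: sum_subtractf image_subset_iff)
      show "(\<Sum>b\<in>{b\<in>cols L. h b = h c}. basic_solution L B' b - basic_solution L B b) = 0"
        if "c \<in> cols L" "h c \<noteq> p0" for c
        using heads[OF sol(1) that] heads[OF sol(2) that] by (simp add: sum_subtractf)
      show "basic_solution L B' k - basic_solution L B k \<noteq> 0" using k by simp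
    qed
  qed (use K(1) K' P in auto)
qed

end

section \<open>The four polytopes\<close>

lemma irredundant_standard_formD:
  assumes irr: "irredundant_form (standard_form S) L"
    and fin: "finite (variables S)" "finite (eq_rows S)" "finite (le_rows S)"
  shows "standard_lp L" "rows L \<subseteq> eq_rows S \<union> le_rows S"
    "cols L = Inl ` variables S \<union> Inr ` le_rows S"
    "mat_A L i = case_sum (lhs S i) (\<lambda>k. of_bool (k = i))" "vec_b L = rhs S"
    "\<And>x i. x \<in> solutions L \<Longrightarrow> i \<in> eq_rows S \<union> le_rows S \<Longrightarrow> (\<Sum>c\<in>cols L. mat_A L i c * x c) = rhs S i"
proof -
  obtain R where R: "R \<subseteq> eq_rows S \<union> le_rows S" "L = (standard_form S)\<lparr>rows := R\<rparr>"
    and sol: "solutions L = solutions (standard_form S)" and rank: "full_row_rank L"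
    using irr by (auto simp: irredundant_form_def standard_form_def)
  show cols: "cols L = Inl ` variables S \<union> Inr ` le_rows S"
    "mat_A L i = case_sum (lhs S i) (\<lambda>k. of_bool (k = i))" "vec_b L = rhs S" for i
    using R(2) by (simp_all add: standard_form_def)
  show "rows L \<subseteq> eq_rows S \<union> le_rows S" using R by simp
  then show "standard_lp L"
    using rank fin cols finite_subset[of "rows L" "eq_rows S \<union> le_rows S"] by (intro standard_lp.intro) auto
  \<comment> \<open>Deleted equations still hold at every solution, because deletion preserves the
    solution set.\<close>
  fix x i assume "x \<in> solutions L" "i \<in> eq_rows S \<union> le_rows S"
  then show "(\<Sum>c\<in>cols L. mat_A L i c * x c) = rhs S i"
    unfolding sol by (auto simp: solutions_def cols standard_form_def)
qed

text \<open>Adding \<open>d\<close> to a solution violates equation \<open>r\<close> and no other.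
  Had \<open>r\<close> been deleted, the shifted point would solve the reduced system but not the
  original one.\<close>

lemma irredundant_rowI:
  assumes irr: "irredundant_form (standard_form S) L"
    and fin: "finite (variables S)" "finite (eq_rows S)" "finite (le_rows S)"
    and x: "x \<in> solutions L" and r: "r \<in> eq_rows S \<union> le_rows S"
    and d0: "\<And>c. c \<notin> cols L \<Longrightarrow> d c = 0"
    and d: "\<And>i. i \<in> eq_rows S \<union> le_rows S \<Longrightarrow> (\<Sum>c\<in>cols L. mat_A L i c * d c) = of_bool (i = r)"
  shows "r \<in> rows L"
proof (rule ccontr)
  assume nr: "r \<notin> rows L"
  note D = irredundant_standard_formD[OF irr fin]
  have sum: "(\<Sum>c\<in>cols L. mat_A L i c * (x c + d c))
      = (\<Sum>c\<in>cols L. mat_A L i c * x c) + (\<Sum>c\<in>cols L. mat_A L i c * d c)" for i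
    by (simp add: distrib_left sum.distrib)
  have "(\<lambda>c. x c + d c) \<in> solutions L"
    unfolding solutions_def
  proof (intro CollectI conjI allI impI ballI)
    fix i assume i: "i \<in> rows L"
    then have "i \<in> eq_rows S \<union> le_rows S" "i \<noteq> r" using D(2) nr by auto
    then show "(\<Sum>c\<in>cols L. mat_A L i c * (x c + d c)) = vec_b L i"
      using D(6)[OF x] d unfolding sum D(5) by simp
  next
    fix c assume "c \<notin> cols L"
    then show "x c + d c = 0" using x d0 by (simp add: solutions_def)
  qed
  from D(6)[OF this r] D(6)[OF x r] d[OF r] sum show False by simp
qed

lemma visits_at_mostI:
  assumes fin: "finite (variables S)" "finite (eq_rows S)" "finite (le_rows S)"
    and run: "\<And>L c Bs T. \<lbrakk>irredundant_form (standard_form S) L; standard_lp L; steepest_edge_run L c Bs T;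
        feasible_basis L (Bs 0)\<rbrakk> \<Longrightarrow>
      \<exists>b. finite (visited_vertices L Bs T) \<and> card (visited_vertices L Bs T) \<le> b \<and> real b \<le> M"
  shows "steepest_edge_visits_at_most S M"
  unfolding steepest_edge_visits_at_most_def
proof (intro allI impI)
  fix L c Bs T
  assume irr: "irredundant_form (standard_form S) L" and r: "steepest_edge_run L c Bs T"
  have "feasible_basis L (Bs 0)" using r by (simp add: steepest_edge_run_def)
  from run[OF irr irredundant_standard_formD(1)[OF irr fin] r this]
  show "finite (visited_vertices L Bs T) \<and> real (card (visited_vertices L Bs T)) \<le> M"
    using of_nat_mono order_trans by blast
qed

text \<open>Absorbs the starting vertex into the factor \<open>m\<close>.\<close>

lemma diff_mult_Suc_le:
  fixes m r K :: nat
  assumes "1 \<le> r" "r \<le> m" "1 \<le> K"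
  shows "(m - r) * K + 1 \<le> m * K"
proof -
  have "(m - r) * K + 1 \<le> (m - r) * K + r * K" using assms by simp
  also have "\<dots> = m * K" using assms by (simp flip: add_mult_distrib)
  finally show ?thesis .
qed

section \<open>Fractional matching polytopes\<close>

text \<open>A slack variable is treated as a half-edge at its node, so that columns of both matching
  polytopes are incidence vectors.\<close>

definition incident_nodes :: "'v set + 'v \<Rightarrow> 'v set" where
  "incident_nodes = case_sum id (\<lambda>v. {v})"

lemma simple_graphD:
  assumes "simple_graph V E"
  shows "finite V" "finite E" "card V \<ge> 1" "\<And>e. e \<in> E \<Longrightarrow> e \<subseteq> V" "\<And>e. e \<in> E \<Longrightarrow> card e = 2"
proof -
  show V: "finite V" and e: "\<And>e. e \<in> E \<Longrightarrow> e \<subseteq> V" and "\<And>e. e \<in> E \<Longrightarrow> card e = 2" using assms by (auto simp: simple_graph_def)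
  show "finite E" using finite_subset[of E "Pow V"] V e by auto
  show "card V \<ge> 1" using assms by (simp add: simple_graph_def Suc_le_eq card_gt_0_iff)
qed

text \<open>Double counting of node-column incidences; it yields the bounds \<open>n/2\<close> and
  \<open>n\<close> on the coordinate sum.\<close>

lemma sum_card_incident_nodes:
  assumes "finite V" "finite C" "\<And>c. c \<in> C \<Longrightarrow> incident_nodes c \<subseteq> V"
    and "\<And>v. v \<in> V \<Longrightarrow> (\<Sum>c\<in>C. of_bool (v \<in> incident_nodes c) * x c) = (1::real)"
  shows "(\<Sum>c\<in>C. real (card (incident_nodes c)) * x c) = real (card V)"
proof -
  have "real (card V) = (\<Sum>v\<in>V. \<Sum>c\<in>C. of_bool (v \<in> incident_nodes c) * x c)" using assms(4) by simp
  also have "\<dots> = (\<Sum>c\<in>C. (\<Sum>v\<in>V. of_bool (v \<in> incident_nodes c)) * x c)"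
    by (subst sum.swap) (simp add: sum_distrib_right)
  also have "\<dots> = (\<Sum>c\<in>C. real (card (incident_nodes c)) * x c)"
    using assms(1,3) by (intro sum.cong refl) (simp add: of_bool_def sum.If_cases Int_absorb1)
  finally show ?thesis by simp
qed

text \<open>The surplus \<open>ln 2\<close> on the right pays for the 1 under the root: the relative
  error of the root is at most \<open>1 / (8 * n)\<close>, and
  \<open>ln n / (8 * n) \<le> 1/8 \<le> ln 2\<close>.\<close>

lemma sqrt_ln_bound_perfect:
  assumes "n \<ge> (1::real)"
  shows "sqrt (4 * n + 1) * ln n \<le> 2 * sqrt n * ln (2 * n)"
proof -
  have n: "sqrt n > 0" using assms by simp
  have "sqrt (4 * n + 1) \<le> 2 * sqrt n * (1 + 1 / (8 * n))"
  proof (rule real_le_lsqrt)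
    have "(2 * sqrt n * (1 + 1 / (8 * n)))\<^sup>2 = 4 * n * (1 + 1 / (8 * n))\<^sup>2"
      using assms by (simp add: power_mult_distrib)
    also have "\<dots> = 4 * n + 1 + 1 / (16 * n)"
      using assms by (simp add: power2_eq_square field_simps)
    finally show "4 * n + 1 \<le> (2 * sqrt n * (1 + 1 / (8 * n)))\<^sup>2" using assms by simp
  qed (use assms in auto)
  then have "sqrt (4 * n + 1) * ln n \<le> 2 * sqrt n * (1 + 1 / (8 * n)) * ln n"
    using assms by (intro mult_right_mono) auto
  also have "\<dots> = 2 * sqrt n * (ln n + ln n / (8 * n))" using assms by (simp add: field_simps)
  also have "\<dots> \<le> 2 * sqrt n * ln (2 * n)"
  proof (rule mult_left_mono)
    have "ln n \<le> n" using ln_le_minus_one[of n] assms by simp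
    then have "ln n / (8 * n) \<le> 1 / 8" using assms by (simp add: field_simps)
    also have "1 / 8 \<le> ln (2::real)" using ln2_ge_two_thirds by simp
    finally show "ln n + ln n / (8 * n) \<le> ln (2 * n)" using assms by (simp add: ln_mult)
  qed (use assms in auto)
  finally show ?thesis .
qed

text \<open>The two roots \<open>sqrt (4 * n + 1)\<close> and \<open>2 * sqrt (2 * n)\<close> differ
  by at least 1/4 and their common factor \<open>2 * n * ln (2 * n)\<close> is at least 4, which
  leaves room for the extra 1.\<close>

lemma sqrt_ln_bound_matching:
  assumes "n \<ge> (2::real)"
  shows "2 * n * sqrt (4 * n + 1) * ln (2 * n) + 1 \<le> 4 * n * sqrt (2 * n) * ln (2 * n)"
proof -
  have "sqrt (4 * n + 1) + 1/4 \<le> sqrt (8 * n)"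
  proof (rule real_le_rsqrt)
    let ?y = "sqrt (4 * n + 1)"
    have "3 \<le> ?y" using assms by (intro real_le_rsqrt) simp
    then have "3 * ?y \<le> ?y * ?y" using assms by (intro mult_right_mono) auto
    moreover have "?y * ?y = 4 * n + 1" using assms by simp
    ultimately have "3 * ?y \<le> 4 * n + 1" by linarith
    with assms have "4 * n + 1 + ?y / 2 + 1 / 16 \<le> 8 * n" by linarith
    moreover have "(?y + 1/4)\<^sup>2 = ?y * ?y + ?y / 2 + 1 / 16" by (simp add: power2_eq_square algebra_simps)
    ultimately show "(?y + 1/4)\<^sup>2 \<le> 8 * n" using \<open>?y * ?y = 4 * n + 1\<close> by linarith
  qed
  moreover have "sqrt (8 * n) = 2 * sqrt (2 * n)"
  proof -
    have "sqrt (8 * n) = sqrt (4 * (2 * n))" by simp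
    also have "\<dots> = 2 * sqrt (2 * n)" by (subst real_sqrt_mult) simp
    finally show ?thesis .
  qed
  ultimately have le: "sqrt (4 * n + 1) + 1/4 \<le> 2 * sqrt (2 * n)" by simp
  have "1 \<le> ln (2 * n)" using assms exp_le by (subst ln_ge_iff) auto
  then have "4 \<le> 2 * n * ln (2 * n)" using mult_mono[of 4 "2 * n" 1 "ln (2 * n)"] assms by simp
  then have "2 * n * sqrt (4 * n + 1) * ln (2 * n) + 1 \<le> 2 * n * ln (2 * n) * (sqrt (4 * n + 1) + 1/4)"
    by (simp add: algebra_simps)
  also have "\<dots> \<le> 2 * n * ln (2 * n) * (2 * sqrt (2 * n))"
    using le \<open>4 \<le> 2 * n * ln (2 * n)\<close> by (intro mult_left_mono) auto
  finally show ?thesis by (simp add: mult_ac)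
qed

lemma fractional_perfect_matching_visits:
  assumes G: "simple_graph V E"
  shows "steepest_edge_visits_at_most (fractional_perfect_matching V E)
    (real (card E) * of_int \<lceil>2 * real (card V) * sqrt (real (card V)) * ln (2 * real (card V))\<rceil>)"
proof -
  let ?S = "fractional_perfect_matching V E"
  define n where "n = card V"
  define a where "a = 2 * real n * sqrt (real n) * ln (2 * real n)"
  define K where "K = nat \<lceil>a\<rceil>"
  note VE = simple_graphD[OF G]
  have n: "n \<ge> 1" using VE by (simp add: n_def)
  have fin: "finite (variables ?S)" "finite (eq_rows ?S)" "finite (le_rows ?S)"
    using VE by (auto simp: fractional_perfect_matching_def)
  have "0 < a" unfolding a_def using n by (intro mult_pos_pos) auto
  then have K: "1 \<le> K" "real K \<ge> a" "real K = of_int \<lceil>a\<rceil>" unfolding K_def by linarith+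
  show ?thesis
  proof (rule visits_at_mostI[OF fin])
    fix L c Bs T
    assume irr: "irredundant_form (standard_form ?S) L" and "standard_lp L"
      and run: "steepest_edge_run L c Bs T" and fb: "feasible_basis L (Bs 0)"
    interpret standard_lp L by fact
    note D = irredundant_standard_formD[OF irr fin]
    have sys: "cols L = Inl ` E" "rows L \<subseteq> V" "vec_b L = (\<lambda>_. 1)"
      using D by (auto simp: fractional_perfect_matching_def)
    have A: "mat_A L i c = of_bool (i \<in> incident_nodes c)" if "c \<in> cols L" for i c
      using that sys(1) D(4)[of i] by (auto simp: incident_nodes_def fractional_perfect_matching_def)
    have deg: "(\<Sum>c\<in>cols L. of_bool (v \<in> incident_nodes c) * x c) = 1" if "x \<in> solutions L" "v \<in> V" for x v
      using D(6)[OF that(1), of v] that(2) by (simp add: A fractional_perfect_matching_def)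
    have in2: "card (incident_nodes c) = 2 \<and> incident_nodes c \<subseteq> V" if "c \<in> cols L" for c
      using that by (auto simp: sys incident_nodes_def VE(5) dest: subsetD[OF VE(4)])
    have s: "(\<Sum>c\<in>cols L. x c) \<le> real n / 2" if "x \<in> feasible_set L" for x
    proof -
      have "(\<Sum>c\<in>cols L. real (card (incident_nodes c)) * x c) = real n"
        unfolding n_def using that in2 deg VE(1) finite_cols
        by (intro sum_card_incident_nodes) (auto simp: feasible_set_def)
      then show ?thesis using in2 by (simp flip: sum_distrib_left)
    qed
    have r: "card (rows L) \<le> n" using sys(2) VE(1) by (simp add: n_def card_mono)
    \<comment> \<open>With all equations deleted the zero vector would be a solution, contradicting
      the degree equation of any node.\<close>
    have r1: "1 \<le> card (rows L)"
    proof -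
      have "V \<noteq> {}" using n by (auto simp: n_def)
      then obtain v where v: "v \<in> V" by blast
      have "rows L \<noteq> {}"
      proof
        assume "rows L = {}"
        then have "(\<lambda>_. 0) \<in> solutions L" by (simp add: solutions_def)
        from deg[OF this v] show False by simp
      qed
      then show ?thesis using finite_rows by (simp add: Suc_le_eq card_gt_0_iff)
    qed
    have rE: "card (rows L) \<le> card (cols L)"
      using fb basisD[of "Bs 0"] card_mono[OF finite_cols, of "Bs 0"] by (auto simp: feasible_basis_def)
    have KK: "real K \<ge> 2 * (real n / 2) * sqrt (4 * real (card (rows L)) + 1) * ln (2 * (real n / 2))"
    proof -
      have "real n * (sqrt (4 * real (card (rows L)) + 1) * ln (real n)) \<le> real n * (sqrt (4 * real n + 1) * ln (real n))"
        using r n by (intro mult_left_mono mult_right_mono) auto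
      also have "\<dots> \<le> real n * (2 * sqrt (real n) * ln (2 * real n))"
        using sqrt_ln_bound_perfect[of "real n"] n by (intro mult_left_mono) auto
      finally show ?thesis using K(2) by (simp add: a_def mult_ac)
    qed
    have "finite (visited_vertices L Bs T) \<and>
      card (visited_vertices L Bs T) \<le> (card (cols L) - card (rows L)) * K + 1"
    proof (rule incidence_run_bound[OF _ A _ run s _ K(1) KK])
      show "\<exists>u v. incident_nodes c = {u, v}" if "c \<in> cols L" for c
        using in2[OF that] by (auto simp: card_2_iff)
    qed (use sys n in auto)
    moreover have "(card (cols L) - card (rows L)) * K + 1 \<le> card E * K"
      using diff_mult_Suc_le[OF r1 rE K(1)] by (simp add: sys card_image)
    ultimately have "finite (visited_vertices L Bs T) \<and> card (visited_vertices L Bs T) \<le> card E * K"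
      by linarith
    then show "\<exists>b. finite (visited_vertices L Bs T) \<and> card (visited_vertices L Bs T) \<le> b \<and>
      real b \<le> real (card E) * of_int \<lceil>2 * real (card V) * sqrt (real (card V)) * ln (2 * real (card V))\<rceil>"
      using K(3) by (intro exI[of _ "card E * K"]) (simp add: a_def n_def)
  qed
qed

lemma fractional_matching_visits:
  assumes G: "simple_graph V E" and m: "card E \<ge> 1"
  shows "steepest_edge_visits_at_most (fractional_matching V E)
    (real (card E) * of_int \<lceil>4 * real (card V) * sqrt (2 * real (card V)) * ln (2 * real (card V))\<rceil>)"
proof -
  let ?S = "fractional_matching V E"
  define n where "n = card V"
  define a where "a = 4 * real n * sqrt (2 * real n) * ln (2 * real n)"
  \<comment> \<open>One below the ceiling: the starting vertex is then covered by
    \<open>card E * K + 1 \<le> card E * (K + 1)\<close>, which holds as there is an edge.\<close>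
  define K where "K = nat (\<lceil>a\<rceil> - 1)"
  note VE = simple_graphD[OF G]
  have n: "n \<ge> 2"
  proof -
    obtain e where "e \<in> E" using m by fastforce
    then show ?thesis using VE(4,5)[of e] card_mono[OF VE(1), of e] by (simp add: n_def)
  qed
  have fin: "finite (variables ?S)" "finite (eq_rows ?S)" "finite (le_rows ?S)"
    using VE by (auto simp: fractional_matching_def)
  have a: "2 * real n * sqrt (4 * real n + 1) * ln (2 * real n) + 1 \<le> a"
    unfolding a_def using n by (intro sqrt_ln_bound_matching) simp
  have "0 < 2 * real n * sqrt (4 * real n + 1) * ln (2 * real n)"
    using n by (intro mult_pos_pos) auto
  then have "1 < a" using a by linarith
  then have K: "1 \<le> K" "real K \<ge> a - 1" "real K + 1 = of_int \<lceil>a\<rceil>" unfolding K_def by linarith+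
  show ?thesis
  proof (rule visits_at_mostI[OF fin])
    fix L c Bs T
    assume irr: "irredundant_form (standard_form ?S) L" and "standard_lp L"
      and run: "steepest_edge_run L c Bs T" and fb: "feasible_basis L (Bs 0)"
    interpret standard_lp L by fact
    note D = irredundant_standard_formD[OF irr fin]
    have sys: "cols L = Inl ` E \<union> Inr ` V" "rows L \<subseteq> V" "vec_b L = (\<lambda>_. 1)"
      using D by (auto simp: fractional_matching_def)
    have A: "mat_A L i c = of_bool (i \<in> incident_nodes c)" if "c \<in> cols L" for i c
      using that sys(1) D(4)[of i] by (auto simp: incident_nodes_def fractional_matching_def)
    have deg: "(\<Sum>c\<in>cols L. of_bool (v \<in> incident_nodes c) * x c) = 1" if "x \<in> solutions L" "v \<in> V" for x v
      using D(6)[OF that(1), of v] that(2) by (simp add: A fractional_matching_def)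
    have in2: "1 \<le> card (incident_nodes c) \<and> incident_nodes c \<subseteq> V" if "c \<in> cols L" for c
      using that by (auto simp: sys incident_nodes_def VE(5) dest: subsetD[OF VE(4)])
    have s: "(\<Sum>c\<in>cols L. x c) \<le> real n" if "x \<in> feasible_set L" for x
    proof -
      have "(\<Sum>c\<in>cols L. x c) \<le> (\<Sum>c\<in>cols L. real (card (incident_nodes c)) * x c)"
      proof (rule sum_mono)
        fix c assume c: "c \<in> cols L"
        have "1 * x c \<le> real (card (incident_nodes c)) * x c"
          using that c in2[OF c] by (intro mult_right_mono) (auto simp: feasible_set_def)
        then show "x c \<le> real (card (incident_nodes c)) * x c" by simp
      qed
      also have "\<dots> = real n"
        unfolding n_def using that in2 deg VE(1) finite_cols
        by (intro sum_card_incident_nodes) (auto simp: feasible_set_def)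
      finally show ?thesis .
    qed
    have sol: "basic_solution L (Bs 0) \<in> solutions L" using fb by (simp add: feasible_basis_def feasible_set_def)
    \<comment> \<open>Changing the slack of \<open>v\<close> affects only the equation of
      \<open>v\<close>, so no equation is redundant.\<close>
    have "V \<subseteq> rows L"
    proof
      fix v assume v: "v \<in> V"
      show "v \<in> rows L"
      proof (rule irredundant_rowI[OF irr fin sol, where d = "\<lambda>c. of_bool (c = Inr v)"])
        fix i assume "i \<in> eq_rows ?S \<union> le_rows ?S"
        have "(\<Sum>c\<in>cols L. mat_A L i c * of_bool (c = Inr v)) = (\<Sum>c\<in>cols L. if c = Inr v then of_bool (i = v) else 0)"
          by (intro sum.cong) (auto simp: A incident_nodes_def)
        then show "(\<Sum>c\<in>cols L. mat_A L i c * of_bool (c = Inr v)) = of_bool (i = v)"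
          using v finite_cols by (simp add: sys(1))
      qed (use v sys in \<open>auto simp: fractional_matching_def\<close>)
    qed
    then have r: "rows L = V" using sys(2) by blast
    have "card (cols L) = card E + n"
      unfolding sys(1) n_def using VE(1,2) by (subst card_Un_disjoint) (auto simp: card_image)
    then have cr: "card (cols L) - card (rows L) = card E" by (simp add: r n_def)
    have KK: "real K \<ge> 2 * real n * sqrt (4 * real (card (rows L)) + 1) * ln (2 * real n)"
      using a K(2) by (simp add: r n_def)
    have "finite (visited_vertices L Bs T) \<and>
      card (visited_vertices L Bs T) \<le> (card (cols L) - card (rows L)) * K + 1"
    proof (rule incidence_run_bound[OF _ A _ run s _ K(1) KK])
      show "\<exists>u v. incident_nodes c = {u, v}" if "c \<in> cols L" for c
      proof (cases c)
        case (Inl e)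
        then show ?thesis using that VE(5)[of e] by (auto simp: sys incident_nodes_def card_2_iff)
      qed (simp add: incident_nodes_def)
    qed (use sys n in auto)
    moreover have "real (card E * K + 1) \<le> real (card E) * (real K + 1)" using m by (simp add: distrib_left)
    ultimately show "\<exists>b. finite (visited_vertices L Bs T) \<and> card (visited_vertices L Bs T) \<le> b \<and>
      real b \<le> real (card E) * of_int \<lceil>4 * real (card V) * sqrt (2 * real (card V)) * ln (2 * real (card V))\<rceil>"
      unfolding cr K(3) a_def n_def by blast
  qed
qed

section \<open>Birkhoff and shortest path polytopes\<close>

lemma sum_of_bool_eq_mult:
  assumes "finite A"
  shows "(\<Sum>i\<in>A. y i * of_bool (i = a)) = (if a \<in> A then y a else (0::real))"
    "(\<Sum>i\<in>A. y i * of_bool (a = i)) = (if a \<in> A then y a else (0::real))"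
proof -
  have "(\<Sum>i\<in>A. y i * of_bool (i = a)) = (\<Sum>i\<in>A. if i = a then y i else 0)" by (intro sum.cong) auto
  then show "(\<Sum>i\<in>A. y i * of_bool (i = a)) = (if a \<in> A then y a else 0)" using assms by simp
  then show "(\<Sum>i\<in>A. y i * of_bool (a = i)) = (if a \<in> A then y a else 0)" by (simp only: eq_commute)
qed

lemma sum_filter_of_bool:
  assumes "finite A" "\<And>c. c \<in> A \<Longrightarrow> f c = of_bool (Q c)"
  shows "(\<Sum>c\<in>{c\<in>A. Q c}. x c) = (\<Sum>c\<in>A. f c * (x c :: real))"
  unfolding sum.inter_filter[OF assms(1)] using assms(2) by (intro sum.cong) auto

lemma birkhoff_visits:
  assumes n2: "n \<ge> 2"
  shows "steepest_edge_visits_at_most (birkhoff n)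
    (real n ^ 2 * of_int \<lceil>real n * sqrt (real n / 2) * ln (2 * real n - 1)\<rceil>)"
proof -
  let ?S = "birkhoff n"
  define a where "a = real n * sqrt (real n / 2) * ln (2 * real n - 1)"
  define K where "K = nat \<lceil>a\<rceil>"
  have fin: "finite (variables ?S)" "finite (eq_rows ?S)" "finite (le_rows ?S)"
    by (auto simp: birkhoff_def)
  have "0 < a" unfolding a_def using n2 by (intro mult_pos_pos) auto
  then have K: "1 \<le> K" "real K \<ge> a" "real K = of_int \<lceil>a\<rceil>" unfolding K_def by linarith+
  have "real n * sqrt (real n / 2) * ln (real n) \<le> a"
    unfolding a_def using n2 by (intro mult_left_mono) auto
  then have KK: "real K \<ge> real n * sqrt (real n / 2) * ln (real n)" using K(2) by linarith
  show ?thesis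
  proof (rule visits_at_mostI[OF fin])
    fix L c Bs T
    assume irr: "irredundant_form (standard_form ?S) L" and "standard_lp L"
      and run: "steepest_edge_run L c Bs T" and fb: "feasible_basis L (Bs 0)"
    interpret standard_lp L by fact
    note D = irredundant_standard_formD[OF irr fin]
    define R :: "(nat + nat) set" where "R = Inl ` {1..n} \<union> Inr ` {1..n}"
    \<comment> \<open>There are no slack columns here, so the \<open>Inr\<close> branches of
      \<open>src\<close> and \<open>dst\<close> are mere default values.\<close>
    define src :: "(nat \<times> nat) + (nat + nat) \<Rightarrow> nat + nat" where "src = case_sum (\<lambda>(i, j). Inl i) id"
    define dst :: "(nat \<times> nat) + (nat + nat) \<Rightarrow> nat + nat" where "dst = case_sum (\<lambda>(i, j). Inr j) id"
    have sys: "cols L = Inl ` ({1..n} \<times> {1..n})" "rows L \<subseteq> R" "vec_b L = (\<lambda>_. 1)"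
      using D by (auto simp: birkhoff_def R_def)
    have A: "mat_A L r c = of_bool (r = src c) + of_bool (r = dst c)" if "c \<in> cols L" for r c
      using that sys(1) D(4)[of r] by (auto simp: src_def dst_def birkhoff_def split: sum.splits)
    have eqs: "(\<Sum>c\<in>cols L. mat_A L r c * x c) = 1" if "x \<in> solutions L" "r \<in> R" for x r
      using D(6)[OF that(1), of r] that(2) by (simp add: birkhoff_def R_def)
    have th: "src c \<in> Inl ` {1..n} \<and> dst c \<in> Inr ` {1..n}" if "c \<in> cols L" for c
      using that by (auto simp: sys src_def dst_def)
    have yA: "(\<Sum>r\<in>rows L. y r * mat_A L r c) = (if src c \<in> rows L then y (src c) else 0)
        + (if dst c \<in> rows L then y (dst c) else 0)" if "c \<in> cols L" for y c
      by (simp only: A[OF that] distrib_left sum.distrib sum_of_bool_eq_mult[OF finite_rows])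
    have r: "card (rows L) + 1 \<le> 2 * n"
    proof -
      have cR: "card R = 2 * n" "finite R" unfolding R_def by (subst card_Un_disjoint) (auto simp: card_image)
      \<comment> \<open>The row equations minus the column equations give a nontrivial dependency,
        so at least one equation must be deleted. This is what makes
        \<open>r + 1 \<le> 2 * n\<close> for the number \<open>r\<close> of remaining rows.\<close>
      have "rows L \<noteq> R"
      proof
        assume eq: "rows L = R"
        have "(\<Sum>r\<in>rows L. case_sum (\<lambda>_. 1) (\<lambda>_. -1) r * mat_A L r c) = (0::real)" if "c \<in> cols L" for c
          unfolding yA[OF that] using th[OF that] eq by (auto simp: R_def)
        then have "\<forall>r\<in>R. case_sum (\<lambda>_. 1) (\<lambda>_. -1) r = (0::real)"
          using full_rank eq unfolding full_row_rank_def by blast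
        from bspec[OF this, of "Inl 1"] show False using n2 by (auto simp: R_def)
      qed
      then have "rows L \<subset> R" using sys(2) by blast
      from psubset_card_mono[OF cR(2) this] show ?thesis using cR(1) by linarith
    qed
    have r1: "1 \<le> card (rows L)"
    proof -
      have "rows L \<noteq> {}"
      proof
        assume "rows L = {}"
        then have "(\<lambda>_. 0) \<in> solutions L" by (simp add: solutions_def)
        moreover have "Inl 1 \<in> R" using n2 by (auto simp: R_def)
        ultimately show False using eqs by fastforce
      qed
      then show ?thesis using finite_rows by (simp add: Suc_le_eq card_gt_0_iff)
    qed
    have rc: "card (rows L) \<le> card (cols L)"
      using fb basisD[of "Bs 0"] card_mono[OF finite_cols, of "Bs 0"] by (auto simp: feasible_basis_def)
    have "finite (visited_vertices L Bs T) \<and>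
      card (visited_vertices L Bs T) \<le> (card (cols L) - card (rows L)) * K + 1"
    \<comment> \<open>No head has the form \<open>Inl 0\<close>, so this choice of \<open>p0\<close>
      exempts nothing.\<close>
    proof (rule transport_run_bound[where t = src and h = dst and N = "rows L" and P = "Inl ` {1..n}"
          and ?p0.0 = "Inl 0" and n = n, OF _ _ _ _ _ _ _ _ _ r run K(1) KK])
      fix y :: "nat + nat \<Rightarrow> real"
      \<comment> \<open>Changing the sign at column nodes turns the bipartite incidence matrix into
        a network matrix; a node whose equation was deleted has potential 0.\<close>
      let ?z = "\<lambda>p. if p \<in> rows L then case p of Inl i \<Rightarrow> y p | Inr j \<Rightarrow> - y p else 0"
      have "(\<Sum>r\<in>rows L. y r * mat_A L r c) = ?z (src c) - ?z (dst c)" if "c \<in> cols L" for c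
        using yA[OF that, of y] th[OF that] by auto
      moreover have "(\<Sum>r\<in>rows L. y r * vec_b L r) \<in> \<int>" if "\<forall>p. ?z p \<in> \<int>"
      proof (intro Ints_sum)
        fix r assume "r \<in> rows L"
        with that[rule_format, of r] show "y r * vec_b L r \<in> \<int>" by (auto simp: sys split: sum.splits)
      qed
      ultimately show "\<exists>z. (\<forall>p. p \<notin> rows L \<longrightarrow> z p = 0) \<and>
        (\<forall>c\<in>cols L. (\<Sum>r\<in>rows L. y r * mat_A L r c) = z (src c) - z (dst c)) \<and>
        ((\<forall>p. z p \<in> \<int>) \<longrightarrow> (\<Sum>r\<in>rows L. y r * vec_b L r) \<in> \<int>)"
        by (intro exI[of _ ?z]) simp
    next
      fix w :: "nat + nat \<Rightarrow> real"
      assume w: "\<And>p. p \<notin> rows L \<Longrightarrow> w p = 0"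
      let ?y = "\<lambda>p. case p of Inl i \<Rightarrow> w p | Inr j \<Rightarrow> - w p"
      have "(\<Sum>r\<in>rows L. ?y r * mat_A L r c) = w (src c) - w (dst c)" if "c \<in> cols L" for c
        using yA[OF that, of ?y] th[OF that] w[of "src c"] w[of "dst c"] by auto
      moreover have "\<forall>p. w p = 0" if "\<forall>r\<in>rows L. ?y r = 0"
      proof
        fix p show "w p = 0" using bspec[OF that, of p] w[of p] by (cases "p \<in> rows L") (auto split: sum.splits)
      qed
      ultimately show "\<exists>y. (\<forall>c\<in>cols L. (\<Sum>r\<in>rows L. y r * mat_A L r c) = w (src c) - w (dst c)) \<and>
          ((\<forall>r\<in>rows L. y r = 0) \<longrightarrow> (\<forall>p. w p = 0))"
        by (intro exI[of _ ?y]) simp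
    next
      show "inj_on (\<lambda>c. (src c, dst c)) (cols L)" by (auto simp: inj_on_def sys src_def dst_def)
    next
      fix x p assume x: "x \<in> solutions L" and p: "p \<in> (Inl ` {1..n} :: (nat + nat) set)"
      have "(\<Sum>c\<in>{c\<in>cols L. src c = p}. x c) = (\<Sum>c\<in>cols L. mat_A L p c * x c)"
      proof (intro sum_filter_of_bool[OF finite_cols])
        fix c assume c: "c \<in> cols L"
        have "p \<noteq> dst c" using th[OF c] p by auto
        then show "mat_A L p c = of_bool (src c = p)" using c by (auto simp: A)
      qed
      then show "(\<Sum>c\<in>{c\<in>cols L. src c = p}. x c) = 1" using eqs[OF x] p by (auto simp: R_def)
    next
      fix x b assume x: "x \<in> solutions L" and b: "b \<in> cols L"
      have "(\<Sum>c\<in>{c\<in>cols L. dst c = dst b}. x c) = (\<Sum>c\<in>cols L. mat_A L (dst b) c * x c)"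
      proof (intro sum_filter_of_bool[OF finite_cols])
        fix c assume c: "c \<in> cols L"
        have "dst b \<noteq> src c" using th[OF c] th[OF b] by auto
        then show "mat_A L (dst b) c = of_bool (dst c = dst b)" using c by (auto simp: A)
      qed
      then show "(\<Sum>c\<in>{c\<in>cols L. dst c = dst b}. x c) = 1" using eqs[OF x] th[OF b] by (auto simp: R_def)
    next
      show "src ` cols L \<subseteq> Inl ` {1..n}" using th by blast
    qed (use n2 in \<open>auto simp: card_image\<close>)
    moreover have "(card (cols L) - card (rows L)) * K + 1 \<le> n\<^sup>2 * K"
      using diff_mult_Suc_le[OF r1 rc K(1)] by (simp add: sys card_image power2_eq_square)
    ultimately have "finite (visited_vertices L Bs T) \<and> card (visited_vertices L Bs T) \<le> n\<^sup>2 * K"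
      by linarith
    then show "\<exists>b. finite (visited_vertices L Bs T) \<and> card (visited_vertices L Bs T) \<le> b \<and>
      real b \<le> real n ^ 2 * of_int \<lceil>real n * sqrt (real n / 2) * ln (2 * real n - 1)\<rceil>"
      using K(3) by (intro exI[of _ "n\<^sup>2 * K"]) (simp add: a_def)
  qed
qed

text \<open>Splitting node \<open>i\<close> into an out-node \<open>Inl i\<close> and an in-node \<open>Inr i\<close>, and reading the slack
  variable of node \<open>k\<close> as an arc from \<open>Inl k\<close> to \<open>Inr k\<close>, turns the shortest path polytope on \<open>n\<close>
  nodes into the Birkhoff polytope on \<open>K\<^bsub>n-1,n-1\<^esub>\<close>.\<close>

lemma shortest_path_visits:
  assumes n3: "n \<ge> 3"
  shows "steepest_edge_visits_at_most (shortest_path n)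
    ((real n ^ 2 - 2 * real n + 1) * of_int \<lceil>(real n - 1) * sqrt (2 * real n / 3) * ln (real n - 1)\<rceil>)"
proof -
  let ?S = "shortest_path n"
  define a where "a = (real n - 1) * sqrt (2 * real n / 3) * ln (real n - 1)"
  define K where "K = nat \<lceil>a\<rceil>"
  define X where "X = {(i, j). i \<in> {1..n-1} \<and> j \<in> {2..n} \<and> i \<noteq> j}"
  have finX: "finite X" by (rule finite_subset[of _ "{1..n-1} \<times> {2..n}"]) (auto simp: X_def)
  have fin: "finite (variables ?S)" "finite (eq_rows ?S)" "finite (le_rows ?S)"
    using finX by (auto simp: shortest_path_def X_def)
  have "0 < a" unfolding a_def using n3 by (intro mult_pos_pos) auto
  then have K: "1 \<le> K" "real K \<ge> a" "real K = of_int \<lceil>a\<rceil>" unfolding K_def by linarith+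
  \<comment> \<open>The Birkhoff bound for \<open>n - 1\<close> fits under the claimed one since
    \<open>(n - 1) / 2 \<le> 2 * n / 3\<close>.\<close>
  have "real (n - 1) * sqrt (real (n - 1) / 2) * ln (real (n - 1)) \<le> a"
    unfolding a_def using n3 by (intro mult_mono) (auto simp: of_nat_diff)
  then have KK: "real K \<ge> real (n - 1) * sqrt (real (n - 1) / 2) * ln (real (n - 1))" using K(2) by linarith
  show ?thesis
  proof (rule visits_at_mostI[OF fin])
    fix L c Bs T
    assume irr: "irredundant_form (standard_form ?S) L" and "standard_lp L"
      and run: "steepest_edge_run L c Bs T" and fb: "feasible_basis L (Bs 0)"
    interpret standard_lp L by fact
    note D = irredundant_standard_formD[OF irr fin]
    define R :: "(nat + nat) set" where "R = Inl ` {1..n-1} \<union> Inr ` {2..n-1}"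
    define src :: "(nat \<times> nat) + (nat + nat) \<Rightarrow> nat + nat"
      where "src = case_sum (\<lambda>(i, j). Inl i) (case_sum Inl Inl)"
    define dst :: "(nat \<times> nat) + (nat + nat) \<Rightarrow> nat + nat"
      where "dst = case_sum (\<lambda>(i, j). Inr j) (case_sum Inr Inr)"
    have sys: "cols L = Inl ` X \<union> Inr ` Inr ` {2..n-1}" "rows L \<subseteq> R"
      "vec_b L = case_sum (\<lambda>k. if k = 1 then 1 else 0) (\<lambda>_. 1)"
      using D by (auto simp: shortest_path_def R_def X_def fun_eq_iff split: sum.splits)
    have R: "eq_rows ?S \<union> le_rows ?S = R" by (simp add: shortest_path_def R_def)
    have eqs: "(\<Sum>c\<in>cols L. mat_A L r c * x c) = vec_b L r" if "x \<in> solutions L" "r \<in> R" for x r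
      using D(6)[OF that(1), of r] that(2) unfolding R D(5) by simp
    have AX: "mat_A L (Inl k) (Inl (i, j)) = of_bool (i = k) - of_bool (j = k)"
      "mat_A L (Inr k) (Inl (i, j)) = of_bool (i = k)"
      "mat_A L r (Inr q) = of_bool (q = r)" for i j k r q
      by (simp_all add: D(4) shortest_path_def)
    have colE: "(\<exists>i j. c = Inl (i, j) \<and> i \<in> {1..n-1} \<and> j \<in> {2..n} \<and> i \<noteq> j) \<or>
        (\<exists>k\<in>{2..n-1}. c = Inr (Inr k))" if "c \<in> cols L" for c
      using that by (auto simp: sys X_def)
    have th: "src c \<in> Inl ` {1..n-1} \<and> dst c \<in> Inr ` {2..n}" if "c \<in> cols L" for c
      using colE[OF that] by (auto simp: src_def dst_def)
    have inj: "inj_on (\<lambda>c. (src c, dst c)) (cols L)" by (auto simp: inj_on_def sys src_def dst_def X_def)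
    have sol: "basic_solution L (Bs 0) \<in> solutions L" using fb by (simp add: feasible_basis_def feasible_set_def)
    have "R \<subseteq> rows L"
    proof
      fix r assume r: "r \<in> R"
      show "r \<in> rows L"
      proof (cases r)
        case (Inr k)
        show ?thesis
        proof (rule irredundant_rowI[OF irr fin sol, where d = "\<lambda>c. of_bool (c = Inr r)"])
          fix i assume "i \<in> eq_rows ?S \<union> le_rows ?S"
          have "Inr r \<in> cols L" using r Inr by (auto simp: R_def sys)
          then show "(\<Sum>c\<in>cols L. mat_A L i c * of_bool (c = Inr r)) = of_bool (i = r)"
            by (simp add: sum_of_bool_eq_mult[OF finite_cols] AX eq_commute)
        qed (use r Inr in \<open>auto simp: R R_def sys\<close>)
      next
        case (Inl k)
        then have k: "k \<in> {1..n-1}" using r by (auto simp: R_def)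
        show ?thesis
        \<comment> \<open>One unit on the arc from \<open>k\<close> to \<open>n\<close> changes the
          balance of \<open>k\<close> only, as node \<open>n\<close> has no equation. For
          \<open>k \<noteq> 1\<close> the slack of \<open>k\<close> is lowered to keep the outflow
          bound intact; node 1 has no such bound.\<close>
        proof (rule irredundant_rowI[OF irr fin sol,
              where d = "\<lambda>c. of_bool (c = Inl (k, n)) - of_bool (k \<noteq> 1) * of_bool (c = Inr (Inr k))"])
          fix i assume i: "i \<in> eq_rows ?S \<union> le_rows ?S"
          have c: "Inl (k, n) \<in> cols L" "k \<noteq> 1 \<Longrightarrow> Inr (Inr k) \<in> cols L" using k n3 by (auto simp: sys X_def)
          have "(\<Sum>c\<in>cols L. mat_A L i c * (of_bool (c = Inl (k, n)) - of_bool (k \<noteq> 1) * of_bool (c = Inr (Inr k))))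
            = (\<Sum>c\<in>cols L. mat_A L i c * of_bool (c = Inl (k, n))) - of_bool (k \<noteq> 1) * (\<Sum>c\<in>cols L. mat_A L i c * of_bool (c = Inr (Inr k)))"
            by (simp add: right_diff_distrib sum_subtractf sum_distrib_left mult.left_commute)
          also have "\<dots> = mat_A L i (Inl (k, n)) - of_bool (k \<noteq> 1) * mat_A L i (Inr (Inr k))"
            using c by (auto simp: sum_of_bool_eq_mult[OF finite_cols])
          also have "\<dots> = of_bool (i = r)"
            using i k n3 unfolding R
            by (auto simp: R_def Inl AX of_bool_def split: if_splits)
          finally show "(\<Sum>c\<in>cols L. mat_A L i c * (of_bool (c = Inl (k, n)) - of_bool (k \<noteq> 1) * of_bool (c = Inr (Inr k))))
            = of_bool (i = r)" .
        next
          fix c assume "c \<notin> cols L"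
          then show "of_bool (c = Inl (k, n)) - of_bool (k \<noteq> 1) * of_bool (c = Inr (Inr k)) = (0::real)"
            using k n3 by (auto simp: sys X_def)
        qed (use r in \<open>simp add: R\<close>)
      qed
    qed
    then have rows: "rows L = R" using sys(2) by blast
    have cR: "card R = (n - 1) + (n - 2)" "finite R" unfolding R_def by (subst card_Un_disjoint) (auto simp: card_image)
    have r: "card (rows L) + 1 \<le> 2 * (n - 1)" "1 \<le> card (rows L)" using cR n3 by (simp_all add: rows)
    have yA: "(\<Sum>r\<in>rows L. y r * mat_A L r c) = (case c of
        Inl (i, j) \<Rightarrow> y (Inl i) - (if j \<noteq> n then y (Inl j) else 0) + (if i \<noteq> 1 then y (Inr i) else 0)
      | Inr q \<Rightarrow> y q)" if c: "c \<in> cols L" for y c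
      using colE[OF c]
    proof (elim disjE exE conjE bexE)
      fix i j assume ij: "c = Inl (i, j)" "i \<in> {1..n-1}" "j \<in> {2..n}" "i \<noteq> j"
      have "mat_A L r c = of_bool (r = Inl i) - of_bool (r = Inl j) + of_bool (r = Inr i)" for r
        by (cases r) (auto simp: ij AX)
      then have "(\<Sum>r\<in>rows L. y r * mat_A L r c) = (if Inl i \<in> R then y (Inl i) else 0)
          - (if Inl j \<in> R then y (Inl j) else 0) + (if Inr i \<in> R then y (Inr i) else 0)"
        by (simp only: distrib_left right_diff_distrib sum.distrib sum_subtractf
            sum_of_bool_eq_mult[OF cR(2)] rows)
      then show ?thesis using ij by (auto simp: R_def)
    next
      fix k assume k: "k \<in> {2..n-1}" "c = Inr (Inr k)"
      then show ?thesis
        by (simp add: AX sum_of_bool_eq_mult[OF finite_rows]) (auto simp: rows R_def)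
    qed
    have rc: "card (rows L) \<le> card (cols L)"
      using fb basisD[of "Bs 0"] card_mono[OF finite_cols, of "Bs 0"] by (auto simp: feasible_basis_def)
    have cc: "card (cols L) \<le> (n - 1)\<^sup>2"
    proof -
      have "card (cols L) \<le> card (Inl ` {1..n-1} \<times> Inr ` {2..n} :: ((nat + nat) \<times> (nat + nat)) set)"
        using th by (intro card_inj_on_le[OF inj]) auto
      then show ?thesis by (simp add: card_cartesian_product card_image power2_eq_square)
    qed
    have "finite (visited_vertices L Bs T) \<and>
      card (visited_vertices L Bs T) \<le> (card (cols L) - card (rows L)) * K + 1"
    proof (rule transport_run_bound[where t = src and h = dst and N = "Inl ` {1..n-1} \<union> Inr ` {2..n-1}"
          and P = "Inl ` {1..n-1}" and ?p0.0 = "Inr n" and n = "n - 1", OF _ _ inj _ _ _ _ _ _ r(1) run K(1) KK])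
      fix y :: "nat + nat \<Rightarrow> real"
      \<comment> \<open>The out-node carries both multipliers of its node, the in-node only that of
        flow conservation; their difference is the multiplier of the outflow bound, as the slack arc
        requires. \<open>R\<close> doubles as the set of split nodes, and the in-node of
        \<open>n\<close> is grounded at 0.\<close>
      define z where "z = (\<lambda>p. if p \<in> R then case p of
          Inl i \<Rightarrow> y (Inl i) + (if i \<noteq> 1 then y (Inr i) else 0) | Inr j \<Rightarrow> y (Inl j) else 0)"
      have zA: "(\<Sum>r\<in>rows L. y r * mat_A L r c) = z (src c) - z (dst c)" if "c \<in> cols L" for c
        using colE[OF that]
      proof (elim disjE exE conjE bexE)
        fix i j assume ij: "c = Inl (i, j)" "i \<in> {1..n-1}" "j \<in> {2..n}" "i \<noteq> j"
        then have "Inl i \<in> R" "Inr j \<in> R \<longleftrightarrow> j \<noteq> n" by (auto simp: R_def)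
        then show ?thesis unfolding yA[OF that] by (simp add: z_def src_def dst_def ij(1))
      next
        fix k assume k: "k \<in> {2..n-1}" "c = Inr (Inr k)"
        then have "Inl k \<in> R" "Inr k \<in> R" "k \<noteq> 1" by (auto simp: R_def)
        then show ?thesis unfolding yA[OF that] by (simp add: z_def src_def dst_def k(2))
      qed
      have zI: "(\<Sum>r\<in>rows L. y r * vec_b L r) \<in> \<int>" if z: "\<forall>p. z p \<in> \<int>"
      proof (intro Ints_sum)
        fix r assume "r \<in> rows L"
        then have r: "r \<in> R" by (simp add: rows)
        show "y r * vec_b L r \<in> \<int>"
        proof (cases r)
          case (Inl k)
          then show ?thesis using r z[rule_format, of "Inl k"] by (auto simp: sys z_def)
        next
          case (Inr k)
          then have "y r = z (Inl k) - z (Inr k)" using r by (auto simp: z_def R_def)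
          then show ?thesis using Inr z by (simp add: sys)
        qed
      qed
      show "\<exists>z. (\<forall>p. p \<notin> Inl ` {1..n-1} \<union> Inr ` {2..n-1} \<longrightarrow> z p = 0) \<and>
        (\<forall>c\<in>cols L. (\<Sum>r\<in>rows L. y r * mat_A L r c) = z (src c) - z (dst c)) \<and>
        ((\<forall>p. z p \<in> \<int>) \<longrightarrow> (\<Sum>r\<in>rows L. y r * vec_b L r) \<in> \<int>)"
        using zA zI by (intro exI[of _ z]) (simp add: z_def R_def)
    next
      fix w :: "nat + nat \<Rightarrow> real"
      assume w: "\<And>p. p \<notin> Inl ` {1..n-1} \<union> Inr ` {2..n-1} \<Longrightarrow> w p = 0"
      \<comment> \<open>The inverse of the passage from \<open>y\<close> to \<open>z\<close>
        above.\<close>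
      define y where "y = (\<lambda>p. case p of Inl k \<Rightarrow> if k = 1 then w (Inl 1) else w (Inr k)
          | Inr k \<Rightarrow> w (Inl k) - w (Inr k))"
      have wn: "w (Inr n) = 0" by (rule w) (use n3 in auto)
      have yw: "(\<Sum>r\<in>rows L. y r * mat_A L r c) = w (src c) - w (dst c)" if "c \<in> cols L" for c
        unfolding yA[OF that] using colE[OF that] wn by (auto simp: y_def src_def dst_def)
      have y0: "\<forall>p. w p = 0" if "\<forall>r\<in>rows L. y r = 0"
      proof -
        have y: "y r = 0" if "r \<in> R" for r using \<open>\<forall>r\<in>rows L. y r = 0\<close> that by (simp add: rows)
        have in0: "w (Inr k) = 0" if "k \<in> {2..n-1}" for k
          using y[of "Inl k"] that by (auto simp: y_def R_def)
        have out0: "w (Inl k) = 0" if "k \<in> {1..n-1}" for k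
        proof (cases "k = 1")
          case True then show ?thesis using y[of "Inl 1"] that by (auto simp: y_def R_def)
        next
          case False
          then have "k \<in> {2..n-1}" using that by auto
          then show ?thesis using y[of "Inr k"] in0[of k] by (auto simp: y_def R_def)
        qed
        show ?thesis
        proof
          fix p show "w p = 0" using w[of p] in0 out0 by (cases "p \<in> Inl ` {1..n-1} \<union> Inr ` {2..n-1}") auto
        qed
      qed
      show "\<exists>y. (\<forall>c\<in>cols L. (\<Sum>r\<in>rows L. y r * mat_A L r c) = w (src c) - w (dst c)) \<and>
          ((\<forall>r\<in>rows L. y r = 0) \<longrightarrow> (\<forall>p. w p = 0))"
        using yw y0 by (intro exI[of _ y]) blast
    next
      fix x p assume x: "x \<in> solutions L" and p: "p \<in> (Inl ` {1..n-1} :: (nat + nat) set)"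
      then obtain k where k: "p = Inl k" "k \<in> {1..n-1}" by auto
      \<comment> \<open>Unit outflow, slack included, is the source equation for node 1 and the
        outflow bound for the others.\<close>
      let ?r = "if k = 1 then Inl 1 else Inr k"
      have "(\<Sum>c\<in>{c\<in>cols L. src c = p}. x c) = (\<Sum>c\<in>cols L. mat_A L ?r c * x c)"
      proof (intro sum_filter_of_bool[OF finite_cols])
        fix c assume "c \<in> cols L"
        from colE[OF this] show "mat_A L ?r c = of_bool (src c = p)"
        proof (elim disjE exE conjE bexE)
          fix i j assume ij: "c = Inl (i, j)" "i \<in> {1..n-1}" "j \<in> {2..n}" "i \<noteq> j"
          then have "j \<noteq> 1" by auto
          then show ?thesis by (simp add: src_def AX ij(1) k(1))
        next
          fix l assume l: "l \<in> {2..n-1}" "c = Inr (Inr l)"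
          then have "l \<noteq> 1" by auto
          then show ?thesis by (simp add: src_def AX l(2) k(1))
        qed
      qed
      also have "\<dots> = 1" using eqs[OF x, of ?r] k(2) by (cases "k = 1") (auto simp: R_def sys)
      finally show "(\<Sum>c\<in>{c\<in>cols L. src c = p}. x c) = 1" .
    next
      fix x b assume x: "x \<in> solutions L" and b: "b \<in> cols L" "dst b \<noteq> Inr n"
      then obtain k where k: "dst b = Inr k" "k \<in> {2..n-1}" using th[OF b(1)] by fastforce
      \<comment> \<open>The outflow bound minus flow conservation says that inflow plus slack is 1.
        Only the in-node of \<open>n\<close> lacks such an equation, hence the choice of
        \<open>p0\<close>.\<close>
      have "(\<Sum>c\<in>{c\<in>cols L. dst c = dst b}. x c) = (\<Sum>c\<in>cols L. (mat_A L (Inr k) c - mat_A L (Inl k) c) * x c)"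
      proof (intro sum_filter_of_bool[OF finite_cols])
        fix c assume "c \<in> cols L"
        from colE[OF this] show "mat_A L (Inr k) c - mat_A L (Inl k) c = of_bool (dst c = dst b)"
          by (elim disjE exE conjE bexE) (simp_all add: dst_def AX k(1)[unfolded dst_def])
      qed
      also have "\<dots> = 1" using eqs[OF x, of "Inr k"] eqs[OF x, of "Inl k"] k(2)
        by (auto simp: R_def sys left_diff_distrib sum_subtractf)
      finally show "(\<Sum>c\<in>{c\<in>cols L. dst c = dst b}. x c) = 1" .
    next
      show "src ` cols L \<subseteq> Inl ` {1..n-1}" using th by blast
    qed (use n3 in \<open>auto simp: card_image\<close>)
    moreover have "(card (cols L) - card (rows L)) * K + 1 \<le> card (cols L) * K"
      by (rule diff_mult_Suc_le[OF r(2) rc K(1)])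
    moreover have "card (cols L) * K \<le> (n - 1)\<^sup>2 * K" using cc by simp
    ultimately have vis: "finite (visited_vertices L Bs T) \<and> card (visited_vertices L Bs T) \<le> (n - 1)\<^sup>2 * K"
      by linarith
    have "real ((n - 1)\<^sup>2 * K) = (real n ^ 2 - 2 * real n + 1) * of_int \<lceil>a\<rceil>"
    proof -
      have "real (n - 1) = real n - 1" using n3 by (simp add: of_nat_diff)
      then show ?thesis using K(3) by (simp add: power2_diff)
    qed
    then show "\<exists>b. finite (visited_vertices L Bs T) \<and> card (visited_vertices L Bs T) \<le> b \<and>
      real b \<le> (real n ^ 2 - 2 * real n + 1) * of_int \<lceil>(real n - 1) * sqrt (2 * real n / 3) * ln (real n - 1)\<rceil>"
      using vis unfolding a_def by (intro exI[of _ "(n - 1)\<^sup>2 * K"]) simp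
  qed
qed

lemma card_complete_graph_edges: "real (card (complete_graph_edges n)) = real n * (real n - 1) / 2"
proof -
  have "card (complete_graph_edges n) = n choose 2"
    using n_subsets[of "{1..n}" 2] by (simp add: complete_graph_edges_def)
  also have "real \<dots> = real n * (real n - 1) / 2"
    by (induction n) (simp_all add: numeral_2_eq_2 field_simps)
  finally show ?thesis .
qed

theorem theorem1p10:
  shows
    "(\<forall>(V :: 'v set) E. simple_graph V E \<longrightarrow>
        (let n = card V; m = card E in
         steepest_edge_visits_at_most (fractional_perfect_matching V E)
           (real m * of_int \<lceil>2 * real n * sqrt (real n) * ln (2 * real n)\<rceil>)))
     \<and> (\<lambda>n. real (card (complete_graph_edges n)) *
              of_int \<lceil>2 * real n * sqrt (real n) * ln (2 * real n)\<rceil>)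
         \<sim>[sequentially] (\<lambda>n. real n ^ 3 * sqrt (real n) * ln (real n))
     \<and> (\<forall>(V :: 'v set) E. simple_graph V E \<longrightarrow> card E \<ge> 1 \<longrightarrow>
        (let n = card V; m = card E in
         steepest_edge_visits_at_most (fractional_matching V E)
           (real m * of_int \<lceil>4 * real n * sqrt (2 * real n) * ln (2 * real n)\<rceil>)))
     \<and> (\<lambda>n. real (card (complete_graph_edges n)) *
              of_int \<lceil>4 * real n * sqrt (2 * real n) * ln (2 * real n)\<rceil>)
         \<sim>[sequentially] (\<lambda>n. 2 * real n ^ 3 * sqrt (2 * real n) * ln (real n))
     \<and> (\<forall>n\<ge>2. steepest_edge_visits_at_most (birkhoff n)
           (real n ^ 2 * of_int \<lceil>real n * sqrt (real n / 2) * ln (2 * real n - 1)\<rceil>))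
     \<and> (\<lambda>n. real n ^ 2 * of_int \<lceil>real n * sqrt (real n / 2) * ln (2 * real n - 1)\<rceil>)
         \<sim>[sequentially] (\<lambda>n. real n ^ 3 * sqrt (real n / 2) * ln (real n))
     \<and> (\<forall>n\<ge>3. steepest_edge_visits_at_most (shortest_path n)
           ((real n ^ 2 - 2 * real n + 1) *
              of_int \<lceil>(real n - 1) * sqrt (2 * real n / 3) * ln (real n - 1)\<rceil>))
     \<and> (\<lambda>n. (real n ^ 2 - 2 * real n + 1) *
              of_int \<lceil>(real n - 1) * sqrt (2 * real n / 3) * ln (real n - 1)\<rceil>)
         \<sim>[sequentially] (\<lambda>n. real n ^ 3 * sqrt (2 * real n / 3) * ln (real n))"
proof (intro conjI allI impI)
  fix V :: "'v set" and E assume "simple_graph V E"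
  then show "let n = card V; m = card E in
      steepest_edge_visits_at_most (fractional_perfect_matching V E)
        (real m * of_int \<lceil>2 * real n * sqrt (real n) * ln (2 * real n)\<rceil>)"
    unfolding Let_def by (rule fractional_perfect_matching_visits)
next
  fix V :: "'v set" and E assume "simple_graph V E" "card E \<ge> 1"
  then show "let n = card V; m = card E in
      steepest_edge_visits_at_most (fractional_matching V E)
        (real m * of_int \<lceil>4 * real n * sqrt (2 * real n) * ln (2 * real n)\<rceil>)"
    unfolding Let_def by (rule fractional_matching_visits)
next
  fix n :: nat assume "n \<ge> 2"
  then show "steepest_edge_visits_at_most (birkhoff n)
      (real n ^ 2 * of_int \<lceil>real n * sqrt (real n / 2) * ln (2 * real n - 1)\<rceil>)"
    by (rule birkhoff_visits)
next
  fix n :: nat assume "n \<ge> 3"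
  then show "steepest_edge_visits_at_most (shortest_path n)
      ((real n ^ 2 - 2 * real n + 1) * of_int \<lceil>(real n - 1) * sqrt (2 * real n / 3) * ln (real n - 1)\<rceil>)"
    by (rule shortest_path_visits)
\<comment> \<open>Only the four asymptotic claims are left: rounding up changes a factor by less
  than 1, and constant factors or shifts inside the logarithm are of lower order.\<close>
qed (unfold card_complete_graph_edges, real_asymp+)

end
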